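(* Let $(\bar x,\bar y)\in S_{\rm Lag}(\bar p)$, where $\bar p=(\bar w,0,0)$. For each $\nu=1,\dots,N$, let $f_\nu:\mathbb R^n\times\mathbb R^d\to\mathbb R$ and $F_\nu:\mathbb R^n\times\mathbb R^d\to\mathcal Y_\nu$ be twice differentiable with respect to $x$ in a neighborhood of $(\bar x,\bar w)$, and suppose that $f_\nu$, $F_\nu$, $\nabla_xf_\nu$ and ${\rm D}_xF_\nu$ are strictly differentiable with respect to $(x,w)$ in this neighborhood. Then $S_{\rm Lag}$ has the Aubin property at $\bar p$ for $(\bar x,\bar y)$ if and only if the following implication holds for all $w_1\in\mathbb R^n$, $w_2\in\mathcal Y$: $$\left.\begin{array}{l}\mathbf G^*w_1-\mathcal A^*w_2\in D^*N_X(\bar x\,|\,-\bar q_1-\mathbf G\bar x-\mathcal B\bar y)(-w_1)\\ \mathcal B^*w_1\in D^*N_{K^\circ}(\bar y\,|\,-\bar q_2+\mathcal A\bar x)(-w_2)\end{array}\right\}\Longrightarrow w_1=0,\ w_2=0.$$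
   Context: **Setting.** There are $N$ players, $n=n_1+\dots+n_N$, $x=(x^1,\dots,x^N)\in\mathbb R^n$ with $x^\nu\in\mathbb R^{n_\nu}$, and $x^{-\nu}$ denotes the blocks of $x$ other than $x^\nu$. For each $\nu$: $X_\nu\subset\mathbb R^{n_\nu}$ is nonempty closed convex, $\mathcal Y_\nu$ is a finite-dimensional Hilbert space, $K_\nu\subset\mathcal Y_\nu$ is a nonempty closed convex cone with polar $K_\nu^\circ=\{y:\langle y,k\rangle\le0\ \forall k\in K_\nu\}$, $f_\nu:\mathbb R^n\times\mathbb R^d\to\mathbb R$, $F_\nu:\mathbb R^n\times\mathbb R^d\to\mathcal Y_\nu$. Put $X=\prod_\nu X_\nu$, $\mathcal Y=\prod_\nu\mathcal Y_\nu$, $K=\prod_\nu K_\nu$, $K^\circ=\prod_\nu K_\nu^\circ$. Given $p=(w,v,u)\in\mathbb R^d\times\mathbb R^n\times\mathcal Y$, player $\nu$ minimizes $f_\nu(x^\nu,x^{-\nu};w)-\langle v^\nu,x^\nu\rangle$ over $x^\nu\in X_\nu$ subject to $F_\nu(x^\nu,x^{-\nu};w)-u^\nu\in K_\nu$, with Lagrangian $L_\nu(x,y^\nu;w,v^\nu,u^\nu)=f_\nu(x;w)-\langle v^\nu,x^\nu\rangle+\langle y^\nu,F_\nu(x;w)-u^\nu\rangle$. The set of Lagrangian generalized Nash equilibria is $$S_{\rm Lag}(p)=\{(x,y)\in\mathbb R^n\times\mathcal Y:\ 0\in\nabla_{x^\nu}L_\nu(x,y^\nu;w,v^\nu,u^\nu)+N_{X_\nu}(x^\nu),\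 0\in-F_\nu(x;w)+u^\nu+N_{K_\nu^\circ}(y^\nu),\ \nu=1,\dots,N\},$$ where $N_C$ is the normal cone mapping of convex analysis (empty off $C$). **Linearization data.** Fix $\bar w\in\mathbb R^d$; $\theta_\nu=f_\nu(\cdot;\bar w)$, $g_\nu=F_\nu(\cdot;\bar w)$, $l_\nu(x,y^\nu)=\theta_\nu(x)+\langle y^\nu,g_\nu(x)\rangle$, $\mathbf l(x,y)=(\nabla_{x^\nu}l_\nu(x,y^\nu))_{\nu=1}^N$, $\mathbf g=(g_1,\dots,g_N)$. $\mathbf G$ is the $n\times n$ matrix with $(\nu,\mu)$ block $\nabla^2_{x^\nu x^\mu}l_\nu(\bar x,\bar y^\nu)$ (derivative in $x^\mu$ of $\nabla_{x^\nu}l_\nu$); $\mathcal B:\mathcal Y\to\mathbb R^n$ is block diagonal with diagonal blocks ${\rm D}_{x^\nu}g_\nu(\bar x)^*$; $\mathcal A={\rm D}\mathbf g(\bar x):\mathbb R^n\to\mathcal Y$; $\bar q_1=\mathbf l(\bar x,\bar y)-\mathbf G\bar x-\mathcal B\bar y$, $\bar q_2=-\mathbf g(\bar x)+\mathcal A\bar x$. (Thus $-\bar q_1-\mathbf G\bar x-\mathcal B\bar y=-\mathbf l(\bar x,\bar y)$ and $-\bar q_2+\mathcal A\bar x=\mathbf g(\bar x)$.) $^*$ on a linear operator denotes the adjoint. **Variational notions.** For a set-valued $S$ with $(\bar a,\bar b)\in{\rm gph}\,S$, the coderivative is $D^*S(\bar a|\bar b)(v)=\{w:(w,-v)\in N_{{\rm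 gph}S}(\bar a,\bar b)\}$, with $N_{{\rm gph}S}$ the limiting (Mordukhovich) normal cone. $S$ has the Aubin property at $\bar a$ for $\bar b\in S(\bar a)$ if there are neighborhoods $U$ of $\bar a$, $V$ of $\bar b$ and $\kappa>0$ with $S(a)\cap V\subset S(a')+\kappa\|a'-a\|\mathbf B$ for all $a,a'\in U$ ($\mathbf B$ the closed unit ball). *)

theory Defs
  imports "HOL-Analysis.Analysis"
begin

subsection \<open>Block structure\<close>

text \<open>
  Products of the players' spaces are encoded as internal orthogonal direct sums, so that the
  block dimensions may differ from player to player.  The players form a finite type \<open>'p\<close>.

  \<open>real ^ 'n\<close> is split by a map \<open>own :: 'n \<Rightarrow> 'p\<close> telling which player controls
  which coordinate.  The space of the \<open>\<nu>\<close>-th block is the coordinate subspace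
  \<open>range (xblk own \<nu>)\<close>, of dimension \<open>card {i. own i = \<nu>}\<close>.  The block of \<open>x\<close> is
  \<open>xblk own \<nu> x\<close>, i.e. \<open>x\<close> with the coordinates of the other players set to 0.

  The product of the Hilbert spaces of the constraints is a Euclidean space \<open>'y\<close> with a family
  \<open>P\<close> of orthogonal projections; the \<open>\<nu>\<close>-th factor is \<open>range (P \<nu>)\<close> (possibly trivial)
  and the \<open>\<nu>\<close>-th block of \<open>y\<close> is \<open>P \<nu> y\<close>.
\<close>

definition xblk :: "('n \<Rightarrow> 'p) \<Rightarrow> 'p \<Rightarrow> real ^ 'n \<Rightarrow> real ^ 'n" where
  "xblk own \<nu> x = (\<chi> i. if own i = \<nu> then x $ i else 0)"

definition orth_decomposition :: "('p::finite \<Rightarrow> 'y::euclidean_space \<Rightarrow> 'y) \<Rightarrow> bool" where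
  "orth_decomposition P \<longleftrightarrow>
     (\<forall>\<nu>. linear (P \<nu>)) \<and>
     (\<forall>\<nu> a b. P \<nu> a \<bullet> b = a \<bullet> P \<nu> b) \<and>
     (\<forall>\<nu> \<mu> a. P \<nu> (P \<mu> a) = (if \<nu> = \<mu> then P \<mu> a else 0)) \<and>
     (\<forall>a. (\<Sum>\<nu>\<in>UNIV. P \<nu> a) = a)"

text \<open>For a family \<open>Q\<close> of block projections and sets \<open>C \<nu>\<close> in the respective blocks.\<close>

definition block_product :: "('p \<Rightarrow> 'a \<Rightarrow> 'a) \<Rightarrow> ('p \<Rightarrow> 'a set) \<Rightarrow> 'a set" where
  "block_product Q C = {x. \<forall>\<nu>. Q \<nu> x \<in> C \<nu>}"


subsection \<open>Convex and variational analysis\<close>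

text \<open>
  The first argument \<open>E\<close> is the ambient subspace in which the cone is taken: the cones of a set
  lying in one block are subsets of that block.
\<close>

definition polar_in :: "'a::real_inner set \<Rightarrow> 'a set \<Rightarrow> 'a set" where
  "polar_in E K = {y \<in> E. \<forall>k\<in>K. y \<bullet> k \<le> 0}"

definition normal_cone_in :: "'a::real_inner set \<Rightarrow> 'a set \<Rightarrow> 'a \<Rightarrow> 'a set" where
  "normal_cone_in E C x = {z \<in> E. x \<in> C \<and> (\<forall>c\<in>C. z \<bullet> (c - x) \<le> 0)}"

abbreviation normal_cone :: "'a::real_inner set \<Rightarrow> 'a \<Rightarrow> 'a set" where
  "normal_cone \<equiv> normal_cone_in UNIV"

text \<open>Regular (Frechet) normals: \<open>limsup \<langle>v, x' - x\<rangle> / \<parallel>x' - x\<parallel> \<le> 0\<close> as \<open>x' \<rightarrow> x\<close> in \<open>S - {x}\<close>.\<close>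

definition regular_normal_cone :: "'a::real_inner set \<Rightarrow> 'a \<Rightarrow> 'a set" where
  "regular_normal_cone S x =
     {v. x \<in> S \<and> (\<forall>\<epsilon>>0. \<forall>\<^sub>F x' in at x within S. v \<bullet> (x' - x) \<le> \<epsilon> * norm (x' - x))}"

definition limiting_normal_cone :: "'a::real_inner set \<Rightarrow> 'a \<Rightarrow> 'a set" where
  "limiting_normal_cone S x =
     {v. x \<in> S \<and> (\<exists>xs vs. xs \<longlonglongrightarrow> x \<and> vs \<longlonglongrightarrow> v \<and> (\<forall>k::nat. vs k \<in> regular_normal_cone S (xs k)))}"

definition gph :: "('a \<Rightarrow> 'b set) \<Rightarrow> ('a \<times> 'b) set" where
  "gph S = {(a, b). b \<in> S a}"

definition coderivative ::
  "('a::real_inner \<Rightarrow> 'b::real_inner set) \<Rightarrow> 'a \<Rightarrow> 'b \<Rightarrow> 'b \<Rightarrow> 'a set" where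
  "coderivative S a b v = {w. (w, - v) \<in> limiting_normal_cone (gph S) (a, b)}"

definition aubin_property ::
  "('a::real_normed_vector \<Rightarrow> 'b::real_normed_vector set) \<Rightarrow> 'a \<Rightarrow> 'b \<Rightarrow> bool" where
  "aubin_property S a b \<longleftrightarrow> b \<in> S a \<and>
     (\<exists>U V \<kappa>. open U \<and> a \<in> U \<and> open V \<and> b \<in> V \<and> \<kappa> > 0 \<and>
        (\<forall>a1\<in>U. \<forall>a2\<in>U.
           S a1 \<inter> V \<subseteq> {s + (\<kappa> * norm (a2 - a1)) *\<^sub>R e | s e. s \<in> S a2 \<and> e \<in> cball 0 1}))"


subsection \<open>Differentiability\<close>

definition gradient :: "('a::real_inner \<Rightarrow> real) \<Rightarrow> 'a \<Rightarrow> 'a" where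
  "gradient h x = (THE g. GDERIV h x :> g)"

text \<open>
  Partial derivatives with respect to the \<open>\<nu>\<close>-th block of \<open>x\<close>.  Only this block is perturbed in
  \<open>t \<mapsto> h (x + xblk own \<nu> t)\<close>, so \<open>pgradient\<close> lies in the \<open>\<nu>\<close>-th block, and \<open>pderivative\<close> is the
  partial derivative precomposed with the projection to the \<open>\<nu>\<close>-th block.
\<close>

definition pgradient ::
  "('n::finite \<Rightarrow> 'p) \<Rightarrow> 'p \<Rightarrow> (real ^ 'n \<Rightarrow> real) \<Rightarrow> real ^ 'n \<Rightarrow> real ^ 'n" where
  "pgradient own \<nu> h x = gradient (\<lambda>t. h (x + xblk own \<nu> t)) 0"

definition pderivative ::
  "('n::finite \<Rightarrow> 'p) \<Rightarrow> 'p \<Rightarrow> (real ^ 'n \<Rightarrow> 'b::real_normed_vector) \<Rightarrow> real ^ 'n \<Rightarrow> real ^ 'n \<Rightarrow> 'b"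
  where
  "pderivative own \<nu> h x = frechet_derivative (\<lambda>t. h (x + xblk own \<nu> t)) (at 0)"

definition strictly_differentiable_at ::
  "('a::real_normed_vector \<Rightarrow> 'b::real_normed_vector) \<Rightarrow> 'a \<Rightarrow> bool" where
  "strictly_differentiable_at h z \<longleftrightarrow>
     (\<exists>D. bounded_linear D \<and>
       (\<forall>\<epsilon>>0. \<exists>\<delta>>0. \<forall>z1\<in>ball z \<delta>. \<forall>z2\<in>ball z \<delta>.
          norm (h z1 - h z2 - D (z1 - z2)) \<le> \<epsilon> * norm (z1 - z2)))"

text \<open>
  A function \<open>h\<close> of \<open>(x, w)\<close> with derivative \<open>Dh x w\<close> in \<open>x\<close> (a gradient or a bounded linear map)
  is twice differentiable in \<open>x\<close>, and \<open>h\<close> and \<open>Dh\<close> are strictly differentiable in \<open>(x, w)\<close>, at all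
  points of \<open>W\<close>.
\<close>

definition smooth_data_on ::
  "('a::real_normed_vector \<times> 'd::real_normed_vector) set \<Rightarrow>
   ('a \<Rightarrow> 'd \<Rightarrow> 'b::real_normed_vector) \<Rightarrow> ('a \<Rightarrow> 'd \<Rightarrow> 'c::real_normed_vector) \<Rightarrow> bool" where
  "smooth_data_on W h Dh \<longleftrightarrow>
     (\<forall>(x, w)\<in>W.
        (\<lambda>x'. h x' w) differentiable (at x) \<and>
        (\<lambda>x'. Dh x' w) differentiable (at x) \<and>
        strictly_differentiable_at (\<lambda>(x', w'). h x' w') (x, w) \<and>
        strictly_differentiable_at (\<lambda>(x', w'). Dh x' w') (x, w))"

definition grad_x :: "('a::real_inner \<Rightarrow> 'd \<Rightarrow> real) \<Rightarrow> 'a \<Rightarrow> 'd \<Rightarrow> 'a" where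
  "grad_x h x w = gradient (\<lambda>x'. h x' w) x"

definition deriv_x ::
  "('a::real_normed_vector \<Rightarrow> 'd \<Rightarrow> 'b::real_normed_vector) \<Rightarrow> 'a \<Rightarrow> 'd \<Rightarrow> 'a \<Rightarrow>\<^sub>L 'b" where
  "deriv_x h x w = Blinfun (frechet_derivative (\<lambda>x'. h x' w) (at x))"


subsection \<open>Lagrangian generalized Nash equilibria\<close>

text \<open>
  In \<open>lagrangian\<close> the arguments \<open>y\<nu>\<close>, \<open>v\<nu>\<close>, \<open>u\<nu>\<close> are already blocks.  At points where a
  partial gradient does not exist, membership in \<open>S_Lag\<close> is unspecified; the Aubin property at a
  point near which the data are smooth does not see such points.
\<close>

definition lagrangian ::
  "('n::finite \<Rightarrow> 'p) \<Rightarrow> ('p \<Rightarrow> real ^ 'n \<Rightarrow> 'd \<Rightarrow> real) \<Rightarrow> ('p \<Rightarrow> real ^ 'n \<Rightarrow> 'd \<Rightarrow> 'y::real_inner) \<Rightarrow>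
   'p \<Rightarrow> real ^ 'n \<Rightarrow> 'y \<Rightarrow> 'd \<Rightarrow> real ^ 'n \<Rightarrow> 'y \<Rightarrow> real" where
  "lagrangian own f F \<nu> x y\<nu> w v\<nu> u\<nu> =
     f \<nu> x w - v\<nu> \<bullet> xblk own \<nu> x + y\<nu> \<bullet> (F \<nu> x w - u\<nu>)"

definition S_Lag ::
  "('n::finite \<Rightarrow> 'p) \<Rightarrow> ('p \<Rightarrow> 'y \<Rightarrow> 'y) \<Rightarrow> ('p \<Rightarrow> (real ^ 'n) set) \<Rightarrow> ('p \<Rightarrow> 'y set) \<Rightarrow>
   ('p \<Rightarrow> real ^ 'n \<Rightarrow> 'd \<Rightarrow> real) \<Rightarrow> ('p \<Rightarrow> real ^ 'n \<Rightarrow> 'd \<Rightarrow> 'y::real_inner) \<Rightarrow>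
   'd \<times> (real ^ 'n) \<times> 'y \<Rightarrow> ((real ^ 'n) \<times> 'y) set" where
  "S_Lag own P X K f F = (\<lambda>(w, v, u). {(x, y). \<forall>\<nu>.
     0 \<in> (+) (pgradient own \<nu> (\<lambda>x'. lagrangian own f F \<nu> x' (P \<nu> y) w (xblk own \<nu> v) (P \<nu> u)) x)
           ` normal_cone_in (range (xblk own \<nu>)) (X \<nu>) (xblk own \<nu> x) \<and>
     0 \<in> (+) (- F \<nu> x w + P \<nu> u)
           ` normal_cone_in (range (P \<nu>)) (polar_in (range (P \<nu>)) (K \<nu>)) (P \<nu> y)})"


subsection \<open>Linearization data\<close>

text \<open>
  Here \<open>\<theta> \<nu> = f \<nu> (\<cdot>, wbar)\<close> and \<open>g \<nu> = F \<nu> (\<cdot>, wbar)\<close>.  Tuples of blocks are formed by summing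
  vectors that lie in the respective blocks.
\<close>

definition l_fun :: "('p \<Rightarrow> 'a \<Rightarrow> real) \<Rightarrow> ('p \<Rightarrow> 'a \<Rightarrow> 'y::real_inner) \<Rightarrow> 'p \<Rightarrow> 'a \<Rightarrow> 'y \<Rightarrow> real" where
  "l_fun \<theta> g \<nu> x y\<nu> = \<theta> \<nu> x + y\<nu> \<bullet> g \<nu> x"

definition l_map ::
  "('n::finite \<Rightarrow> 'p::finite) \<Rightarrow> ('p \<Rightarrow> 'y \<Rightarrow> 'y) \<Rightarrow> ('p \<Rightarrow> real ^ 'n \<Rightarrow> real) \<Rightarrow>
   ('p \<Rightarrow> real ^ 'n \<Rightarrow> 'y::real_inner) \<Rightarrow> real ^ 'n \<Rightarrow> 'y \<Rightarrow> real ^ 'n" where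
  "l_map own P \<theta> g x y = (\<Sum>\<nu>\<in>UNIV. pgradient own \<nu> (\<lambda>x'. l_fun \<theta> g \<nu> x' (P \<nu> y)) x)"

definition g_map :: "('p::finite \<Rightarrow> 'a \<Rightarrow> 'y::real_inner) \<Rightarrow> 'a \<Rightarrow> 'y" where
  "g_map g x = (\<Sum>\<nu>\<in>UNIV. g \<nu> x)"

text \<open>
  \<open>G_op\<close> is the linear operator of the matrix with \<open>(\<nu>, \<mu>)\<close> block the partial derivative in
  \<open>x\<^sup>\<mu>\<close> of the partial gradient of \<open>l_fun\<close> in \<open>x\<^sup>\<nu>\<close>.
\<close>

definition G_op ::
  "('n::finite \<Rightarrow> 'p::finite) \<Rightarrow> ('p \<Rightarrow> 'y \<Rightarrow> 'y) \<Rightarrow> ('p \<Rightarrow> real ^ 'n \<Rightarrow> real) \<Rightarrow>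
   ('p \<Rightarrow> real ^ 'n \<Rightarrow> 'y::real_inner) \<Rightarrow> real ^ 'n \<Rightarrow> 'y \<Rightarrow> real ^ 'n \<Rightarrow> real ^ 'n" where
  "G_op own P \<theta> g x y h =
     (\<Sum>\<nu>\<in>UNIV. \<Sum>\<mu>\<in>UNIV.
        pderivative own \<mu> (pgradient own \<nu> (\<lambda>x'. l_fun \<theta> g \<nu> x' (P \<nu> y))) x (xblk own \<mu> h))"

definition B_op ::
  "('n::finite \<Rightarrow> 'p::finite) \<Rightarrow> ('p \<Rightarrow> 'y \<Rightarrow> 'y) \<Rightarrow> ('p \<Rightarrow> real ^ 'n \<Rightarrow> 'y::real_inner) \<Rightarrow>
   real ^ 'n \<Rightarrow> 'y \<Rightarrow> real ^ 'n" where
  "B_op own P g x k = (\<Sum>\<nu>\<in>UNIV. adjoint (pderivative own \<nu> (g \<nu>) x) (P \<nu> k))"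

definition A_op :: "('p::finite \<Rightarrow> 'a::real_normed_vector \<Rightarrow> 'y::real_inner) \<Rightarrow> 'a \<Rightarrow> 'a \<Rightarrow> 'y" where
  "A_op g x = frechet_derivative (g_map g) (at x)"

end

(*
  Write z = (x, y) and let Gamma be the graph of the normal cone mapping of the product of X and the
  polar cone.  The equilibria are the solutions z of J q - Phi (z, w) : Gamma (z), where Phi is strictly
  differentiable, q = (v, u) and J (v, u) = (v, - u); Gamma is closed.  With T the adjoint of the partial
  derivative of Phi in z, the coderivative condition says that (T eta, eta) is a limiting normal to
  Gamma only for eta = 0, because limiting normal cones of products are products.

  If this holds, no unit vector e makes (T e, e) an approximate normal to Gamma near the base point.
  Given a solution z for p and a nearby p', minimize the residual at p' plus a small multiple of the
  distance to z over Gamma.  A minimizer with nonzero residual would give such an approximate normal,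
  so it solves the problem for p', and it is as close to z as the Aubin property demands.

  Conversely, at a regular normal (a, b) close to (T eta, eta) perturb q in the direction b: the Aubin
  property gives a solution at proportional distance, and testing (a, b) against the resulting
  displacement in Gamma bounds the norm of b by an arbitrarily small number.
*)

theory Submission
  imports Defs
begin

section \<open>Strict differentiability\<close>

text \<open>For a fixed parameter the residual is the norm of
  \<open>\<Phi> (z, w') + \<zeta> - J q'\<close> on \<open>\<Gamma>\<close>. Where it is nonzero,
  its gradient is, up to a small error, \<open>(T e, e)\<close> with \<open>e\<close> the normalized
  residual vector; hence the role of these pairs. Since the base point moves, increments are
  compared between two points near it, which is what strict differentiability controls. Minimality
  yields the normal inequality only with an error of fixed size, so normals with error are objects
  of their own, turned into regular normals by projection. Compactness of the unit sphere lets one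
  \<open>\<epsilon>\<close> serve all \<open>e\<close>, and it determines the Aubin modulus
  \<open>(L + 1) * 4 / \<epsilon>\<close>. In the converse the parameter \<open>q\<close> shifts the
  equation by an arbitrary vector, so every point of \<open>\<Gamma>\<close> near the base is a
  solution for some \<open>q\<close>. The radius on which a regular normal may be tested can shrink
  along the approximating sequence; all estimates are linear in the step length, which
  cancels.\<close>

definition has_strict_derivative ::
  "('a::real_normed_vector \<Rightarrow> 'b::real_normed_vector) \<Rightarrow> ('a \<Rightarrow> 'b) \<Rightarrow> 'a \<Rightarrow> bool" where
  "has_strict_derivative h D z \<longleftrightarrow> bounded_linear D \<and>
     (\<forall>\<epsilon>>0. \<forall>\<^sub>F p in nhds (z, z).
        norm (h (fst p) - h (snd p) - D (fst p - snd p)) \<le> \<epsilon> * norm (fst p - snd p))"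

text \<open>Links the filter form, in which several estimates combine easily, with the two-point
  ball form of \<open>strictly_differentiable_at\<close>.\<close>

lemma eventually_nhds_diag:
  fixes z :: "'a::metric_space"
  shows "eventually Q (nhds (z, z)) \<longleftrightarrow> (\<exists>\<delta>>0. \<forall>z1\<in>ball z \<delta>. \<forall>z2\<in>ball z \<delta>. Q (z1, z2))"
proof
  assume "eventually Q (nhds (z, z))"
  then obtain R where R: "eventually R (nhds z)" "\<And>a b. R a \<Longrightarrow> R b \<Longrightarrow> Q (a, b)"
    unfolding nhds_prod eventually_prod_same by blast
  from R(1) obtain \<delta> where "\<delta> > 0" "\<And>a. dist a z < \<delta> \<Longrightarrow> R a"
    unfolding eventually_nhds_metric by blast
  then show "\<exists>\<delta>>0. \<forall>z1\<in>ball z \<delta>. \<forall>z2\<in>ball z \<delta>. Q (z1, z2)"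
    using R(2) by (metis dist_commute mem_ball)
next
  assume "\<exists>\<delta>>0. \<forall>z1\<in>ball z \<delta>. \<forall>z2\<in>ball z \<delta>. Q (z1, z2)"
  then obtain \<delta> where \<delta>: "\<delta> > 0" "\<forall>z1\<in>ball z \<delta>. \<forall>z2\<in>ball z \<delta>. Q (z1, z2)"
    by blast
  show "eventually Q (nhds (z, z))"
    unfolding nhds_prod eventually_prod_same
  proof (intro exI conjI allI impI)
    show "\<forall>\<^sub>F a in nhds z. a \<in> ball z \<delta>"
      using \<delta>(1) by (intro eventually_nhds_in_open) auto
  qed (use \<delta>(2) in blast)
qed

lemma strictly_differentiable_at_iff:
  "strictly_differentiable_at h z \<longleftrightarrow> (\<exists>D. has_strict_derivative h D z)"
  unfolding strictly_differentiable_at_def has_strict_derivative_def eventually_nhds_diag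
  by simp

lemma has_strict_derivative_bounded_linear:
  "has_strict_derivative h D z \<Longrightarrow> bounded_linear D"
  by (simp add: has_strict_derivative_def)

lemma has_strict_derivativeD:
  assumes "has_strict_derivative h D z" "\<epsilon> > 0"
  shows "\<forall>\<^sub>F p in nhds (z, z).
    norm (h (fst p) - h (snd p) - D (fst p - snd p)) \<le> \<epsilon> * norm (fst p - snd p)"
  using assms by (simp add: has_strict_derivative_def)

lemma has_strict_derivative_ballD:
  assumes "has_strict_derivative h D z" "\<epsilon> > 0"
  obtains \<delta> where "\<delta> > 0" and "\<And>a b. norm (a - z) < \<delta> \<Longrightarrow> norm (b - z) < \<delta> \<Longrightarrow>
    norm (h a - h b - D (a - b)) \<le> \<epsilon> * norm (a - b)"
  using has_strict_derivativeD[OF assms]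
  unfolding eventually_nhds_diag by (auto simp: dist_norm norm_minus_commute)

lemma has_strict_derivative_imp_has_derivative:
  assumes "has_strict_derivative h D z"
  shows "(h has_derivative D) (at z)"
  unfolding has_derivative_at_alt
proof (intro conjI allI impI)
  show "bounded_linear D"
    by (rule has_strict_derivative_bounded_linear[OF assms])
  fix e :: real assume "e > 0"
  from has_strict_derivative_ballD[OF assms this] obtain \<delta> where "\<delta> > 0"
    "\<And>a b. norm (a - z) < \<delta> \<Longrightarrow> norm (b - z) < \<delta> \<Longrightarrow>
      norm (h a - h b - D (a - b)) \<le> e * norm (a - b)" by metis
  then show "\<exists>d>0. \<forall>y. norm (y - z) < d \<longrightarrow> norm (h y - h z - D (y - z)) \<le> e * norm (y - z)"
    by (intro exI[of _ \<delta>]) auto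
qed

lemma has_strict_derivative_Lipschitz:
  assumes "has_strict_derivative h D z"
  obtains L where "L > 0" and "\<forall>\<^sub>F p in nhds (z, z). norm (h (fst p) - h (snd p)) \<le> L * norm (fst p - snd p)"
proof -
  obtain c where c: "c > 0" "\<And>x. norm (D x) \<le> norm x * c"
    using bounded_linear.pos_bounded[OF has_strict_derivative_bounded_linear[OF assms]] by blast
  have "\<forall>\<^sub>F p in nhds (z, z). norm (h (fst p) - h (snd p)) \<le> (1 + c) * norm (fst p - snd p)"
    using has_strict_derivativeD[OF assms zero_less_one]
  proof eventually_elim
    case (elim p)
    have "norm (h (fst p) - h (snd p)) \<le>
        norm (h (fst p) - h (snd p) - D (fst p - snd p)) + norm (D (fst p - snd p))"
      by norm
    with elim c(2)[of "fst p - snd p"] show ?case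
      by (simp add: algebra_simps)
  qed
  then show thesis using c(1) by (intro that[of "1 + c"]) auto
qed

lemma has_strict_derivative_linear:
  "bounded_linear D \<Longrightarrow> has_strict_derivative D D z"
  by (auto simp: has_strict_derivative_def bounded_linear.linear linear_diff)

text \<open>The error splits into the outer error on the increment of \<open>k\<close>, which is
  Lipschitz, and the image under \<open>Dh\<close> of the inner error. The tolerances
  \<open>e / 2 / L\<close> and \<open>e / 2 / c\<close> give each half of the budget.\<close>

lemma has_strict_derivative_compose:
  assumes k: "has_strict_derivative k Dk z" and h: "has_strict_derivative h Dh (k z)"
  shows "has_strict_derivative (\<lambda>x. h (k x)) (\<lambda>x. Dh (Dk x)) z"
  unfolding has_strict_derivative_def
proof (intro conjI allI impI)
  note bl = has_strict_derivative_bounded_linear[OF k] has_strict_derivative_bounded_linear[OF h]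
  show "bounded_linear (\<lambda>x. Dh (Dk x))"
    using bl by (rule bounded_linear_compose[rotated])
  fix e :: real assume e: "e > 0"
  obtain c where c: "c > 0" "\<And>x. norm (Dh x) \<le> norm x * c"
    using bounded_linear.pos_bounded[OF bl(2)] by blast
  obtain L where L: "L > 0"
    "\<forall>\<^sub>F p in nhds (z, z). norm (k (fst p) - k (snd p)) \<le> L * norm (fst p - snd p)"
    using has_strict_derivative_Lipschitz[OF k] by blast
  have "isCont k z"
    using has_strict_derivative_imp_has_derivative[OF k] by (rule has_derivative_continuous)
  then have "((\<lambda>p. (k (fst p), k (snd p))) \<longlongrightarrow> (k z, k z)) (nhds (z, z))"
    by (intro tendsto_Pair)
      (auto simp: nhds_prod isCont_def tendsto_at_iff_tendsto_nhds
        intro: filterlim_compose[OF _ filterlim_fst] filterlim_compose[OF _ filterlim_snd])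
  then have kk: "\<forall>\<^sub>F p in nhds (z, z). norm (h (k (fst p)) - h (k (snd p)) - Dh (k (fst p) - k (snd p)))
      \<le> e / 2 / L * norm (k (fst p) - k (snd p))"
    using has_strict_derivativeD[OF h, of "e / 2 / L"] e L(1)
    by (auto simp: filterlim_iff)
  have kd: "\<forall>\<^sub>F p in nhds (z, z). norm (k (fst p) - k (snd p) - Dk (fst p - snd p)) \<le> e / 2 / c * norm (fst p - snd p)"
    using has_strict_derivativeD[OF k, of "e / 2 / c"] e c(1) by simp
  from kk kd L(2)
  show "\<forall>\<^sub>F p in nhds (z, z).
    norm (h (k (fst p)) - h (k (snd p)) - Dh (Dk (fst p - snd p))) \<le> e * norm (fst p - snd p)"
  proof eventually_elim
    case (elim p)
    let ?kd = "k (fst p) - k (snd p)" and ?d = "fst p - snd p"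
    have "h (k (fst p)) - h (k (snd p)) - Dh (Dk ?d) =
        (h (k (fst p)) - h (k (snd p)) - Dh ?kd) + Dh (?kd - Dk ?d)"
      by (simp add: bounded_linear.linear[OF bl(2)] linear_diff)
    then have "norm (h (k (fst p)) - h (k (snd p)) - Dh (Dk ?d)) \<le>
        norm (h (k (fst p)) - h (k (snd p)) - Dh ?kd) + norm (Dh (?kd - Dk ?d))"
      by (metis norm_triangle_ineq)
    also have "\<dots> \<le> e / 2 / L * (L * norm ?d) + (e / 2 / c * norm ?d) * c"
    proof (intro add_mono)
      show "norm (h (k (fst p)) - h (k (snd p)) - Dh ?kd) \<le> e / 2 / L * (L * norm ?d)"
        using elim(1,3) e L(1) by (meson divide_nonneg_pos dual_order.strict_implies_order
          mult_left_mono order_trans half_gt_zero)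
      show "norm (Dh (?kd - Dk ?d)) \<le> (e / 2 / c * norm ?d) * c"
        using c elim(2) by (meson dual_order.strict_implies_order mult_right_mono order_trans)
    qed
    also have "\<dots> = e * norm ?d"
      using L(1) c(1) by (simp add: field_simps)
    finally show ?case .
  qed
qed

lemma has_strict_derivative_Pair:
  assumes h: "has_strict_derivative h Dh z" and k: "has_strict_derivative k Dk z"
  shows "has_strict_derivative (\<lambda>x. (h x, k x)) (\<lambda>x. (Dh x, Dk x)) z"
  unfolding has_strict_derivative_def
proof (intro conjI allI impI)
  show "bounded_linear (\<lambda>x. (Dh x, Dk x))"
    by (intro bounded_linear_Pair has_strict_derivative_bounded_linear[OF h]
        has_strict_derivative_bounded_linear[OF k])
  fix e :: real assume "e > 0"
  then have "e / 2 > 0" by simp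
  from has_strict_derivativeD[OF h this] has_strict_derivativeD[OF k this]
  show "\<forall>\<^sub>F p in nhds (z, z). norm ((h (fst p), k (fst p)) - (h (snd p), k (snd p))
      - (Dh (fst p - snd p), Dk (fst p - snd p))) \<le> e * norm (fst p - snd p)"
  proof eventually_elim
    case (elim p)
    then show ?case
      using norm_Pair_le[of "h (fst p) - h (snd p) - Dh (fst p - snd p)"
          "k (fst p) - k (snd p) - Dk (fst p - snd p)"]
      by (simp add: algebra_simps)
  qed
qed

text \<open>The remainder is exactly \<open>pr (a1 - a2) (b1 - b0) + pr (a2 - a0) (b1 - b2)\<close>:
  in each term one factor is an increment and the other is bounded by the radius
  \<open>d\<close>.\<close>

lemma has_strict_derivative_bounded_bilinear:
  assumes "bounded_bilinear pr"
  shows "has_strict_derivative (\<lambda>(a, b). pr a b) (\<lambda>(a, b). pr a b0 + pr a0 b) (a0, b0)"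
  unfolding has_strict_derivative_def
proof (intro conjI allI impI)
  interpret bounded_bilinear pr by fact
  have *: "bounded_linear (\<lambda>x. pr (fst x) b0 + pr a0 (snd x))"
    by (intro bounded_linear_add bounded_linear_compose[OF bounded_linear_left bounded_linear_fst]
        bounded_linear_compose[OF bounded_linear_right bounded_linear_snd])
  then show "bounded_linear (\<lambda>(a, b). pr a b0 + pr a0 b)"
    by (simp add: case_prod_unfold)
  fix e :: real assume e: "e > 0"
  obtain c where c: "c > 0" "\<And>a b. norm (pr a b) \<le> norm a * norm b * c"
    using pos_bounded by blast
  define d where "d = e / 2 / c"
  have d: "d > 0" using e c by (simp add: d_def)
  show "\<forall>\<^sub>F p in nhds ((a0, b0), (a0, b0)).
      norm ((case fst p of (a, b) \<Rightarrow> pr a b) - (case snd p of (a, b) \<Rightarrow> pr a b)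
        - (case fst p - snd p of (a, b) \<Rightarrow> pr a b0 + pr a0 b)) \<le> e * norm (fst p - snd p)"
    unfolding eventually_nhds_diag
  proof (intro exI[of _ d] conjI d ballI)
    fix p q assume "p \<in> ball (a0, b0) d" "q \<in> ball (a0, b0) d"
    moreover obtain a1 b1 a2 b2 where pq: "p = (a1, b1)" "q = (a2, b2)"
      by (cases p, cases q)
    ultimately have n: "norm (b1 - b0) \<le> d" "norm (a2 - a0) \<le> d"
      using dist_snd_le[of "(a0, b0)" "(a1, b1)"] dist_fst_le[of "(a0, b0)" "(a2, b2)"]
      by (auto simp: dist_norm norm_minus_commute[of b1 b0] norm_minus_commute[of a2 a0] simp del: diff_Pair)
    have le: "norm (a1 - a2) \<le> norm (p - q)" "norm (b1 - b2) \<le> norm (p - q)"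
      by (simp_all add: pq norm_fst_le norm_snd_le)
    have "pr a1 b1 - pr a2 b2 - (pr (a1 - a2) b0 + pr a0 (b1 - b2)) =
        pr (a1 - a2) (b1 - b0) + pr (a2 - a0) (b1 - b2)"
      by (simp add: diff_left diff_right)
    then have "norm (pr a1 b1 - pr a2 b2 - (pr (a1 - a2) b0 + pr a0 (b1 - b2))) \<le>
        norm (pr (a1 - a2) (b1 - b0)) + norm (pr (a2 - a0) (b1 - b2))"
      by (metis norm_triangle_ineq)
    also have "\<dots> \<le> norm (p - q) * d * c + d * norm (p - q) * c"
      using c n le d
      by (intro add_mono order_trans[OF c(2)] mult_right_mono mult_mono) auto
    also have "\<dots> = e * norm (p - q)"
      using c by (simp add: d_def field_simps)
    finally show "norm ((case fst (p, q) of (a, b) \<Rightarrow> pr a b) - (case snd (p, q) of (a, b) \<Rightarrow> pr a b)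
        - (case fst (p, q) - snd (p, q) of (a, b) \<Rightarrow> pr a b0 + pr a0 b)) \<le> e * norm (fst (p, q) - snd (p, q))"
      by (simp add: pq)
  qed
qed

lemma has_strict_derivative_linear_compose:
  assumes "bounded_linear T" "has_strict_derivative h D z"
  shows "has_strict_derivative (\<lambda>x. T (h x)) (\<lambda>x. T (D x)) z"
  using has_strict_derivative_compose[OF assms(2) has_strict_derivative_linear[OF assms(1)]] .

lemma has_strict_derivative_bilinear_compose:
  assumes "bounded_bilinear pr" "has_strict_derivative h Dh z" "has_strict_derivative k Dk z"
  shows "has_strict_derivative (\<lambda>x. pr (h x) (k x)) (\<lambda>x. pr (Dh x) (k z) + pr (h z) (Dk x)) z"
  using has_strict_derivative_compose[OF has_strict_derivative_Pair[OF assms(2,3)]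
      has_strict_derivative_bounded_bilinear[OF assms(1)]]
  by simp

lemma has_strict_derivative_add:
  assumes "has_strict_derivative h Dh z" "has_strict_derivative k Dk z"
  shows "has_strict_derivative (\<lambda>x. h x + k x) (\<lambda>x. Dh x + Dk x) z"
  using has_strict_derivative_linear_compose[OF bounded_linear_add[OF bounded_linear_fst bounded_linear_snd]
      has_strict_derivative_Pair[OF assms]]
  by simp

lemma has_strict_derivative_zero: "has_strict_derivative (\<lambda>x. 0) (\<lambda>x. 0) z"
  by (rule has_strict_derivative_linear) (rule bounded_linear_zero)

lemma has_strict_derivative_sum:
  assumes "\<And>i. i \<in> I \<Longrightarrow> has_strict_derivative (h i) (D i) z"
  shows "has_strict_derivative (\<lambda>x. \<Sum>i\<in>I. h i x) (\<lambda>x. \<Sum>i\<in>I. D i x) z"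
  using assms
  by (induction I rule: infinite_finite_induct)
    (auto intro: has_strict_derivative_zero has_strict_derivative_add)

section \<open>Normal cones\<close>

text \<open>Normals with a fixed error. Minimization over a closed set produces these; limiting
  normals reappear as the error tends to 0.\<close>

definition eps_normal :: "real \<Rightarrow> 'a::real_inner set \<Rightarrow> 'a \<Rightarrow> 'a \<Rightarrow> bool" where
  "eps_normal \<epsilon> S x v \<longleftrightarrow> x \<in> S \<and>
     (\<exists>\<delta>>0. \<forall>x'\<in>S. norm (x' - x) < \<delta> \<longrightarrow> v \<bullet> (x' - x) \<le> \<epsilon> * norm (x' - x))"

text \<open>The punctured filter omits only \<open>x' = x\<close>, where both sides of the
  inequality vanish.\<close>

lemma regular_normal_cone_iff_eps:
  "v \<in> regular_normal_cone S x \<longleftrightarrow> x \<in> S \<and> (\<forall>\<epsilon>>0. eps_normal \<epsilon> S x v)"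
proof -
  have *: "(\<forall>\<^sub>F x' in at x within S. v \<bullet> (x' - x) \<le> \<epsilon> * norm (x' - x)) \<longleftrightarrow>
      (\<exists>\<delta>>0. \<forall>x'\<in>S. norm (x' - x) < \<delta> \<longrightarrow> v \<bullet> (x' - x) \<le> \<epsilon> * norm (x' - x))" for \<epsilon>
    unfolding eventually_at dist_norm
    by (metis diff_self inner_zero_right mult_zero_right norm_zero order_refl)
  show ?thesis
    unfolding regular_normal_cone_def eps_normal_def mem_Collect_eq * by auto
qed

lemma norm_diff_squared:
  fixes a b :: "'a::real_inner"
  shows "(norm (a - b))\<^sup>2 = (norm a)\<^sup>2 - 2 * (a \<bullet> b) + (norm b)\<^sup>2"
  by (simp add: power2_norm_eq_inner inner_diff_left inner_diff_right inner_commute)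

text \<open>Comparing squared distances bounds \<open>(a - s) \<bullet> (x - s)\<close> by half the
  square of \<open>norm (x - s)\<close>, a second-order quantity; hence the radius
  \<open>2 * t * \<epsilon>\<close>.\<close>

lemma proximal_normal_regular:
  fixes S :: "'a::real_inner set"
  assumes "s \<in> S" "t > 0" and min: "\<And>x. x \<in> S \<Longrightarrow> norm (a - s) \<le> norm (a - x)"
  shows "(a - s) /\<^sub>R t \<in> regular_normal_cone S s"
  unfolding regular_normal_cone_iff_eps eps_normal_def
proof (intro conjI allI impI assms(1))
  fix \<epsilon> :: real assume \<epsilon>: "\<epsilon> > 0"
  show "\<exists>\<delta>>0. \<forall>x'\<in>S. norm (x' - s) < \<delta> \<longrightarrow> ((a - s) /\<^sub>R t) \<bullet> (x' - s) \<le> \<epsilon> * norm (x' - s)"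
  proof (intro exI[of _ "2 * t * \<epsilon>"] conjI ballI impI)
    show "2 * t * \<epsilon> > 0" using \<epsilon> assms by simp
    fix x assume x: "x \<in> S" "norm (x - s) < 2 * t * \<epsilon>"
    have "(norm (a - s))\<^sup>2 \<le> (norm ((a - s) - (x - s)))\<^sup>2"
      using min[OF x(1)] by simp
    then have "2 * ((a - s) \<bullet> (x - s)) \<le> (norm (x - s))\<^sup>2"
      unfolding norm_diff_squared[of "a - s"] by simp
    also have "\<dots> \<le> 2 * t * \<epsilon> * norm (x - s)"
      using x(2) by (simp add: power2_eq_square mult_right_mono)
    finally show "((a - s) /\<^sub>R t) \<bullet> (x - s) \<le> \<epsilon> * norm (x - s)"
      using assms(2) by (simp add: divide_simps mult_ac)
  qed
qed

text \<open>The regular normal is the proximal one at the projection of \<open>x + t v\<close> for small \<open>t\<close>.\<close>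

lemma eps_normal_approx:
  fixes S :: "'a::euclidean_space set"
  assumes "closed S" "eps_normal \<epsilon> S x v" "\<epsilon> > 0"
  obtains x' v' where "v' \<in> regular_normal_cone S x'" "norm (x' - x) \<le> \<epsilon>" "norm (v' - v) \<le> 2 * \<epsilon>"
proof -
  from assms(2) obtain \<delta> where xS: "x \<in> S" and \<delta>: "\<delta> > 0"
    "\<And>x'. x' \<in> S \<Longrightarrow> norm (x' - x) < \<delta> \<Longrightarrow> v \<bullet> (x' - x) \<le> \<epsilon> * norm (x' - x)"
    unfolding eps_normal_def by blast
  \<comment> \<open>The second bound keeps the projection, at distance at most
    \<open>2 * t * norm v\<close> from \<open>x\<close>, where the normal inequality is available;
    \<open>1/2\<close> makes \<open>2 * t * \<epsilon>\<close> at most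
    \<open>\<epsilon>\<close>.\<close>
  define t where "t = min (1/2) (\<delta> / (2 * (norm v + 1)))"
  have "t > 0"
    unfolding t_def using \<delta>(1) by (auto intro!: divide_pos_pos add_nonneg_pos)
  moreover have "t \<le> 1/2"
    unfolding t_def by (rule min.cobounded1)
  ultimately have t: "t > 0" "t \<le> 1/2" .
  have "2 * t * norm v < 2 * t * (norm v + 1)" using t by simp
  also have "\<dots> \<le> 2 * (\<delta> / (2 * (norm v + 1))) * (norm v + 1)"
    by (intro mult_right_mono mult_left_mono) (auto simp: t_def)
  also have "\<dots> = \<delta>"
  proof -
    have "2 * norm v + 2 \<noteq> 0" using norm_ge_zero[of v] by linarith
    then show ?thesis by (simp add: divide_simps algebra_simps)
  qed
  finally have tv: "2 * t * norm v < \<delta>" .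
  obtain s where s: "s \<in> S" "\<And>y. y \<in> S \<Longrightarrow> dist (x + t *\<^sub>R v) s \<le> dist (x + t *\<^sub>R v) y"
    using distance_attains_inf[OF assms(1), of "x + t *\<^sub>R v"] xS by blast
  have min: "norm (x + t *\<^sub>R v - s) \<le> norm (x + t *\<^sub>R v - y)" if "y \<in> S" for y
    using s(2)[OF that] by (simp add: dist_norm)
  have le: "norm (t *\<^sub>R v - (s - x)) \<le> norm (t *\<^sub>R v)"
    using min[OF xS] by (simp add: algebra_simps)
  have "norm (s - x) \<le> norm (t *\<^sub>R v) + norm (t *\<^sub>R v - (s - x))"
    using norm_triangle_ineq4[of "t *\<^sub>R v" "t *\<^sub>R v - (s - x)"] by simp
  also have "\<dots> \<le> 2 * t * norm v" using le t by simp
  finally have near: "norm (s - x) < \<delta>" using tv by simp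
  \<comment> \<open>The crude bound \<open>2 * t * norm v\<close> served only to reach the normal
    inequality. Inserted into the expanded square, that inequality improves the bound on
    \<open>norm (s - x)\<close> to \<open>2 * t * \<epsilon>\<close>.\<close>
  have "(norm (t *\<^sub>R v - (s - x)))\<^sup>2 \<le> (norm (t *\<^sub>R v))\<^sup>2"
    using le by simp
  then have "(norm (s - x))\<^sup>2 \<le> 2 * (t * (v \<bullet> (s - x)))"
    unfolding norm_diff_squared[of "t *\<^sub>R v"] by simp
  also have "\<dots> \<le> 2 * (t * (\<epsilon> * norm (s - x)))"
    using \<delta>(2)[OF s(1) near] t by simp
  finally have "norm (s - x) * norm (s - x) \<le> (2 * t * \<epsilon>) * norm (s - x)"
    by (simp add: power2_eq_square mult_ac)
  then have sx: "norm (s - x) \<le> 2 * t * \<epsilon>"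
    using t(1) assms(3) by (cases "s = x") (auto simp only: mult_le_cancel_right zero_less_norm_iff norm_zero, simp_all)
  show thesis
  proof (rule that)
    show "(x + t *\<^sub>R v - s) /\<^sub>R t \<in> regular_normal_cone S s"
      by (rule proximal_normal_regular[OF s(1) t(1) min])
    have "2 * t * \<epsilon> \<le> 1 * \<epsilon>" using t assms(3) by (intro mult_right_mono) auto
    then show "norm (s - x) \<le> \<epsilon>" using sx by simp
    have "(x + t *\<^sub>R v - s) /\<^sub>R t - v = (x - s) /\<^sub>R t"
      using t(1) by (simp add: algebra_simps)
    then have "norm ((x + t *\<^sub>R v - s) /\<^sub>R t - v) = norm (s - x) / t"
      using t(1) by (simp add: norm_minus_commute divide_inverse_commute)
    also have "\<dots> \<le> 2 * \<epsilon>" using sx t(1) by (simp add: field_simps)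
    finally show "norm ((x + t *\<^sub>R v - s) /\<^sub>R t - v) \<le> 2 * \<epsilon>" .
  qed
qed

text \<open>Each approximate normal has a regular one nearby, with errors
  \<open>\<epsilon> k\<close> in the point and \<open>2 * \<epsilon> k\<close> in the vector; both
  vanish in the limit.\<close>

lemma eps_normal_limit:
  fixes S :: "'a::euclidean_space set"
  assumes "closed S" "x \<in> S" and "\<And>k::nat. eps_normal (\<epsilon> k) S (xs k) (vs k)" "\<And>k. \<epsilon> k > 0"
    and "\<epsilon> \<longlonglongrightarrow> 0" "xs \<longlonglongrightarrow> x" "vs \<longlonglongrightarrow> v"
  shows "v \<in> limiting_normal_cone S x"
proof -
  have "\<forall>k. \<exists>x' v'. v' \<in> regular_normal_cone S x' \<and> norm (x' - xs k) \<le> \<epsilon> k \<and> norm (v' - vs k) \<le> 2 * \<epsilon> k"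
    using eps_normal_approx[OF assms(1,3,4)] by metis
  then obtain xs' vs' where a: "\<And>k. vs' k \<in> regular_normal_cone S (xs' k)"
    "\<And>k. norm (xs' k - xs k) \<le> \<epsilon> k" "\<And>k. norm (vs' k - vs k) \<le> 2 * \<epsilon> k"
    by metis
  have "(\<lambda>k. xs' k - xs k) \<longlonglongrightarrow> 0"
    by (rule Lim_null_comparison[OF _ assms(5)]) (auto simp: a)
  from tendsto_add[OF this assms(6)] have 1: "xs' \<longlonglongrightarrow> x" by simp
  have "(\<lambda>k. vs' k - vs k) \<longlonglongrightarrow> 0"
    using tendsto_mult_right_zero[OF assms(5), of 2]
    by (rule Lim_null_comparison[rotated]) (auto simp: a)
  from tendsto_add[OF this assms(7)] have 2: "vs' \<longlonglongrightarrow> v" by simp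
  show ?thesis
    unfolding limiting_normal_cone_def using 1 2 a(1) assms(2) by blast
qed

section \<open>Normals to a product of two graphs, regrouped as a graph over the product
  space\<close>

definition prod_rearrange :: "('a \<times> 'c) set \<Rightarrow> ('b \<times> 'd) set \<Rightarrow> (('a \<times> 'b) \<times> ('c \<times> 'd)) set" where
  "prod_rearrange S T = {((a, b), (c, d)). (a, c) \<in> S \<and> (b, d) \<in> T}"

text \<open>Freezing one component at the base point turns a displacement in a factor into one of
  the same norm in the product, so the error constant is unchanged.\<close>

lemma eps_normal_prod_rearrange1:
  assumes "eps_normal \<epsilon> (prod_rearrange S T) ((a, b), (c, d)) ((u, v), (w, z))"
  shows "eps_normal \<epsilon> S (a, c) (u, w)" "eps_normal \<epsilon> T (b, d) (v, z)"
proof -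
  from assms obtain \<delta> where m: "(a, c) \<in> S" "(b, d) \<in> T" and \<delta>: "\<delta> > 0"
    "\<And>p. p \<in> prod_rearrange S T \<Longrightarrow> norm (p - ((a, b), (c, d))) < \<delta> \<Longrightarrow>
      ((u, v), (w, z)) \<bullet> (p - ((a, b), (c, d))) \<le> \<epsilon> * norm (p - ((a, b), (c, d)))"
    unfolding eps_normal_def by (auto simp: prod_rearrange_def)
  show "eps_normal \<epsilon> S (a, c) (u, w)"
    unfolding eps_normal_def
  proof (intro conjI exI[of _ \<delta>] m \<delta>(1) ballI impI)
    fix p assume "p \<in> S" "norm (p - (a, c)) < \<delta>"
    then show "(u, w) \<bullet> (p - (a, c)) \<le> \<epsilon> * norm (p - (a, c))"
      using \<delta>(2)[of "((fst p, b), (snd p, d))"] m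
      by (cases p) (auto simp: prod_rearrange_def norm_Pair)
  qed
  show "eps_normal \<epsilon> T (b, d) (v, z)"
    unfolding eps_normal_def
  proof (intro conjI exI[of _ \<delta>] m \<delta>(1) ballI impI)
    fix p assume "p \<in> T" "norm (p - (b, d)) < \<delta>"
    then show "(v, z) \<bullet> (p - (b, d)) \<le> \<epsilon> * norm (p - (b, d))"
      using \<delta>(2)[of "((a, fst p), (c, snd p))"] m
      by (cases p) (auto simp: prod_rearrange_def norm_Pair)
  qed
qed

text \<open>The two inequalities are added; neither factor displacement is longer than the whole
  one, hence the 2.\<close>

lemma eps_normal_prod_rearrange2:
  assumes "eps_normal \<epsilon> S (a, c) (u, w)" "eps_normal \<epsilon> T (b, d) (v, z)" "\<epsilon> > 0"
  shows "eps_normal (2 * \<epsilon>) (prod_rearrange S T) ((a, b), (c, d)) ((u, v), (w, z))"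
proof -
  from assms obtain \<delta>1 \<delta>2 where m: "(a, c) \<in> S" "(b, d) \<in> T" and \<delta>: "\<delta>1 > 0" "\<delta>2 > 0"
    "\<And>p. p \<in> S \<Longrightarrow> norm (p - (a, c)) < \<delta>1 \<Longrightarrow> (u, w) \<bullet> (p - (a, c)) \<le> \<epsilon> * norm (p - (a, c))"
    "\<And>p. p \<in> T \<Longrightarrow> norm (p - (b, d)) < \<delta>2 \<Longrightarrow> (v, z) \<bullet> (p - (b, d)) \<le> \<epsilon> * norm (p - (b, d))"
    unfolding eps_normal_def by auto
  show ?thesis
    unfolding eps_normal_def
  proof (intro conjI exI[of _ "min \<delta>1 \<delta>2"] ballI impI)
    show "((a, b), (c, d)) \<in> prod_rearrange S T" using m by (simp add: prod_rearrange_def)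
    show "min \<delta>1 \<delta>2 > 0" using \<delta> by simp
    fix p assume p: "p \<in> prod_rearrange S T" "norm (p - ((a, b), (c, d))) < min \<delta>1 \<delta>2"
    obtain a' b' c' d' where p_eq: "p = ((a', b'), (c', d'))" by (metis surj_pair)
    let ?n = "norm (p - ((a, b), (c, d)))"
    have n: "norm ((a', c') - (a, c)) \<le> ?n" "norm ((b', d') - (b, d)) \<le> ?n"
      by (auto simp: p_eq norm_Pair)
    have "(u, w) \<bullet> ((a', c') - (a, c)) \<le> \<epsilon> * ?n"
      using \<delta>(3)[of "(a', c')"] p n(1) assms(3)
      by (fastforce simp: p_eq prod_rearrange_def intro: order_trans mult_left_mono)
    moreover have "(v, z) \<bullet> ((b', d') - (b, d)) \<le> \<epsilon> * ?n"
      using \<delta>(4)[of "(b', d')"] p n(2) assms(3)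
      by (fastforce simp: p_eq prod_rearrange_def intro: order_trans mult_left_mono)
    ultimately show "((u, v), (w, z)) \<bullet> (p - ((a, b), (c, d))) \<le> 2 * \<epsilon> * ?n"
      by (simp add: p_eq)
  qed
qed

lemma regular_normal_cone_prod_rearrange:
  "((u, v), (w, z)) \<in> regular_normal_cone (prod_rearrange S T) ((a, b), (c, d)) \<longleftrightarrow>
     (u, w) \<in> regular_normal_cone S (a, c) \<and> (v, z) \<in> regular_normal_cone T (b, d)"
  (is "?L \<longleftrightarrow> ?R")
proof
  assume ?L
  then show ?R
    unfolding regular_normal_cone_iff_eps
    using eps_normal_prod_rearrange1[of _ S T a b c d u v w z] by (auto simp: prod_rearrange_def)
next
  assume R: ?R
  have "eps_normal \<epsilon> (prod_rearrange S T) ((a, b), (c, d)) ((u, v), (w, z))" if "\<epsilon> > 0" for \<epsilon>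
    using eps_normal_prod_rearrange2[of "\<epsilon> / 2" S a c u w T b d v z] R that
    by (auto simp: regular_normal_cone_iff_eps)
  with R show ?L
    by (auto simp: regular_normal_cone_iff_eps prod_rearrange_def)
qed

text \<open>Regular normals split exactly at every point, so approximating sequences can be taken
  apart, or paired along the common index.\<close>

lemma limiting_normal_cone_prod_rearrange:
  "((u, v), (w, z)) \<in> limiting_normal_cone (prod_rearrange S T) ((a, b), (c, d)) \<longleftrightarrow>
     (u, w) \<in> limiting_normal_cone S (a, c) \<and> (v, z) \<in> limiting_normal_cone T (b, d)"
  (is "?L \<longleftrightarrow> ?R")
proof
  assume ?L
  then obtain ps qs where m: "(a, c) \<in> S" "(b, d) \<in> T" and
    lim: "ps \<longlonglongrightarrow> ((a, b), (c, d))" "qs \<longlonglongrightarrow> ((u, v), (w, z))" and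
    reg: "\<And>k::nat. qs k \<in> regular_normal_cone (prod_rearrange S T) (ps k)"
    unfolding limiting_normal_cone_def by (auto simp: prod_rearrange_def)
  let ?p1 = "\<lambda>k. (fst (fst (ps k)), fst (snd (ps k)))" and ?q1 = "\<lambda>k. (fst (fst (qs k)), fst (snd (qs k)))"
  let ?p2 = "\<lambda>k. (snd (fst (ps k)), snd (snd (ps k)))" and ?q2 = "\<lambda>k. (snd (fst (qs k)), snd (snd (qs k)))"
  have reg': "?q1 k \<in> regular_normal_cone S (?p1 k) \<and> ?q2 k \<in> regular_normal_cone T (?p2 k)" for k
    using reg[of k] by (cases "ps k"; cases "qs k") (auto simp: regular_normal_cone_prod_rearrange)
  have "?p1 \<longlonglongrightarrow> (a, c)" "?q1 \<longlonglongrightarrow> (u, w)" "?p2 \<longlonglongrightarrow> (b, d)" "?q2 \<longlonglongrightarrow> (v, z)"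
    using tendsto_Pair[OF lim(1)[THEN tendsto_fst, THEN tendsto_fst] lim(1)[THEN tendsto_snd, THEN tendsto_fst]]
      tendsto_Pair[OF lim(2)[THEN tendsto_fst, THEN tendsto_fst] lim(2)[THEN tendsto_snd, THEN tendsto_fst]]
      tendsto_Pair[OF lim(1)[THEN tendsto_fst, THEN tendsto_snd] lim(1)[THEN tendsto_snd, THEN tendsto_snd]]
      tendsto_Pair[OF lim(2)[THEN tendsto_fst, THEN tendsto_snd] lim(2)[THEN tendsto_snd, THEN tendsto_snd]]
    by simp_all
  with m reg' show ?R
    unfolding limiting_normal_cone_def mem_Collect_eq by blast
next
  assume ?R
  then obtain ps qs ps' qs' where m: "(a, c) \<in> S" "(b, d) \<in> T" and
    lim: "ps \<longlonglongrightarrow> (a, c)" "qs \<longlonglongrightarrow> (u, w)" "ps' \<longlonglongrightarrow> (b, d)" "qs' \<longlonglongrightarrow> (v, z)" and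
    reg: "\<And>k::nat. qs k \<in> regular_normal_cone S (ps k)" "\<And>k::nat. qs' k \<in> regular_normal_cone T (ps' k)"
    unfolding limiting_normal_cone_def by auto
  let ?p = "\<lambda>k. ((fst (ps k), fst (ps' k)), (snd (ps k), snd (ps' k)))"
  let ?q = "\<lambda>k. ((fst (qs k), fst (qs' k)), (snd (qs k), snd (qs' k)))"
  have "?q k \<in> regular_normal_cone (prod_rearrange S T) (?p k)" for k
    using reg by (simp add: regular_normal_cone_prod_rearrange)
  moreover have "?p \<longlonglongrightarrow> ((a, b), (c, d))"
    using lim(1,3)[THEN tendsto_fst] lim(1,3)[THEN tendsto_snd] by (auto intro!: tendsto_Pair)
  moreover have "?q \<longlonglongrightarrow> ((u, v), (w, z))"
    using lim(2,4)[THEN tendsto_fst] lim(2,4)[THEN tendsto_snd] by (auto intro!: tendsto_Pair)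
  moreover have "((a, b), (c, d)) \<in> prod_rearrange S T"
    using m by (simp add: prod_rearrange_def)
  ultimately show ?L
    unfolding limiting_normal_cone_def mem_Collect_eq by blast
qed

section \<open>Generalized equations with canonical perturbations\<close>

lemma aubin_property_iff:
  "aubin_property S a b \<longleftrightarrow> b \<in> S a \<and>
     (\<exists>U V \<kappa>. open U \<and> a \<in> U \<and> open V \<and> b \<in> V \<and> \<kappa> > 0 \<and>
        (\<forall>a1\<in>U. \<forall>a2\<in>U. \<forall>z\<in>S a1 \<inter> V. \<exists>s\<in>S a2. norm (z - s) \<le> \<kappa> * norm (a2 - a1)))"
proof -
  have *: "z \<in> {s + (\<kappa> * norm (a2 - a1)) *\<^sub>R e | s e. s \<in> S a2 \<and> e \<in> cball 0 1} \<longleftrightarrow>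
      (\<exists>s\<in>S a2. norm (z - s) \<le> \<kappa> * norm (a2 - a1))" if "\<kappa> > 0" for z \<kappa> a1 a2
  proof
    assume "z \<in> {s + (\<kappa> * norm (a2 - a1)) *\<^sub>R e | s e. s \<in> S a2 \<and> e \<in> cball 0 1}"
    then obtain s e where se: "z = s + (\<kappa> * norm (a2 - a1)) *\<^sub>R e" "s \<in> S a2" "norm e \<le> 1"
      by auto
    have "norm (z - s) = \<kappa> * norm (a2 - a1) * norm e"
      using that by (simp add: se(1))
    also have "\<dots> \<le> \<kappa> * norm (a2 - a1) * 1"
      using that se(3) by (intro mult_left_mono) auto
    finally show "\<exists>s\<in>S a2. norm (z - s) \<le> \<kappa> * norm (a2 - a1)"
      using se(2) by auto
  next
    assume "\<exists>s\<in>S a2. norm (z - s) \<le> \<kappa> * norm (a2 - a1)"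
    then obtain s where s: "s \<in> S a2" "norm (z - s) \<le> \<kappa> * norm (a2 - a1)" by blast
    define r where "r = \<kappa> * norm (a2 - a1)"
    have "r \<ge> 0" using that by (simp add: r_def)
    \<comment> \<open>For \<open>r = 0\<close> the bound forces \<open>z = s\<close>, and the
      quotient is 0 by convention, which lies in the unit ball.\<close>
    have *: "z = s + r *\<^sub>R ((z - s) /\<^sub>R r)"
      using s(2) by (cases "r = 0") (auto simp: r_def[symmetric])
    have "norm ((z - s) /\<^sub>R r) \<le> 1"
      using s(2) \<open>r \<ge> 0\<close> by (cases "r = 0") (auto simp: r_def[symmetric] divide_simps)
    with * show "z \<in> {s + (\<kappa> * norm (a2 - a1)) *\<^sub>R e | s e. s \<in> S a2 \<and> e \<in> cball 0 1}"
      using s(1) unfolding r_def[symmetric] mem_Collect_eq mem_cball_0 by blast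
  qed
  show ?thesis
    unfolding aubin_property_def subset_eq using * by (simp cong: conj_cong)
qed

text \<open>Comes from \<open>(norm (c + d) - norm c)\<^sup>2 \<ge> 0\<close>. It replaces
  differentiating the norm at \<open>c\<close> by an explicit quadratic remainder.\<close>

lemma norm_add_le_linearization:
  fixes c d :: "'a::real_inner"
  assumes "c \<noteq> 0"
  shows "norm (c + d) \<le> norm c + (c /\<^sub>R norm c) \<bullet> d + (norm d)\<^sup>2 / (2 * norm c)"
proof -
  have "0 \<le> (norm (c + d) - norm c)\<^sup>2" by simp
  then have "2 * norm c * norm (c + d) \<le> (norm c)\<^sup>2 + (norm (c + d))\<^sup>2"
    by (simp add: power2_diff algebra_simps)
  also have "(norm (c + d))\<^sup>2 = (norm c)\<^sup>2 + 2 * (c \<bullet> d) + (norm d)\<^sup>2"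
    by (simp add: power2_norm_eq_inner inner_add_left inner_add_right inner_commute)
  finally have "norm (c + d) \<le> (2 * (norm c)\<^sup>2 + 2 * (c \<bullet> d) + (norm d)\<^sup>2) / (2 * norm c)"
    using assms by (simp add: pos_le_divide_eq mult_ac)
  also have "\<dots> = norm c + (c /\<^sub>R norm c) \<bullet> d + (norm d)\<^sup>2 / (2 * norm c)"
    using assms by (simp add: field_simps power2_eq_square)
  finally show ?thesis .
qed

text \<open>Otherwise unit vectors with errors \<open>inverse (Suc k)\<close> subconverge on the
  compact sphere, and their limit, still of norm 1, contradicts \<open>inj\<close>. The same
  \<open>\<epsilon>\<close> bounds the location of \<open>p\<close> and the normal error.\<close>

lemma no_eps_normals:
  fixes \<Gamma> :: "('z::euclidean_space \<times> 'z) set" and T :: "'z \<Rightarrow> 'z"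
  assumes cl: "closed \<Gamma>" and m: "(zb, \<zeta>b) \<in> \<Gamma>" and T: "linear T"
    and inj: "\<And>\<eta>. (T \<eta>, \<eta>) \<in> limiting_normal_cone \<Gamma> (zb, \<zeta>b) \<Longrightarrow> \<eta> = 0"
  obtains \<epsilon> where "\<epsilon> > 0" "\<And>p e. norm e = 1 \<Longrightarrow> norm (p - (zb, \<zeta>b)) < \<epsilon> \<Longrightarrow> \<not> eps_normal \<epsilon> \<Gamma> p (T e, e)"
proof -
  have "\<exists>\<epsilon>>0. \<forall>p e. norm e = 1 \<longrightarrow> norm (p - (zb, \<zeta>b)) < \<epsilon> \<longrightarrow> \<not> eps_normal \<epsilon> \<Gamma> p (T e, e)"
  proof (rule ccontr)
    assume "\<not> ?thesis"
    then have "\<forall>k::nat. \<exists>p e. norm e = 1 \<and> norm (p - (zb, \<zeta>b)) < inverse (Suc k) \<and>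
        eps_normal (inverse (Suc k)) \<Gamma> p (T e, e)"
      by (metis of_nat_0_less_iff positive_imp_inverse_positive zero_less_Suc)
    then obtain ps es where pe: "\<And>k. norm (es k) = 1" "\<And>k::nat. norm (ps k - (zb, \<zeta>b)) < inverse (Suc k)"
        "\<And>k. eps_normal (inverse (Suc k)) \<Gamma> (ps k) (T (es k), es k)"
      by metis
    have "compact (sphere (0::'z) 1)" by simp
    moreover have "\<forall>k. es k \<in> sphere 0 1" using pe(1) by simp
    ultimately obtain e r where e: "e \<in> sphere 0 1" "strict_mono r" "(es \<circ> r) \<longlonglongrightarrow> e"
      unfolding compact_def by metis
    have inv: "(\<lambda>k. inverse (real (Suc k))) \<longlonglongrightarrow> 0" by (rule LIMSEQ_inverse_real_of_nat)
    have "(\<lambda>k. ps k - (zb, \<zeta>b)) \<longlonglongrightarrow> 0"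
      by (rule Lim_null_comparison[OF _ inv]) (intro always_eventually allI less_imp_le pe(2))
    then have "ps \<longlonglongrightarrow> (zb, \<zeta>b)" by (rule Lim_null[THEN iffD2])
    then have 1: "(ps \<circ> r) \<longlonglongrightarrow> (zb, \<zeta>b)" using e(2) by (rule LIMSEQ_subseq_LIMSEQ)
    have "(\<lambda>k. (T ((es \<circ> r) k), (es \<circ> r) k)) \<longlonglongrightarrow> (T e, e)"
      using bounded_linear.tendsto[OF T[unfolded linear_conv_bounded_linear] e(3)]
      by (intro tendsto_Pair e(3))
    then have "(T e, e) \<in> limiting_normal_cone \<Gamma> (zb, \<zeta>b)"
      using pe(3) 1 LIMSEQ_subseq_LIMSEQ[OF inv e(2)]
      by (intro eps_normal_limit[OF cl m, where \<epsilon> = "(\<lambda>k. inverse (real (Suc k))) \<circ> r" and xs = "ps \<circ> r"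
            and vs = "\<lambda>k. (T ((es \<circ> r) k), (es \<circ> r) k)"]) auto
    from inj[OF this] e(1) show False by simp
  qed
  then show thesis using that by blast
qed

text \<open>The isometry \<open>J\<close> absorbs the opposite signs with which the two
  perturbations enter. \<open>local_solutions\<close> restricts \<open>(z, w)\<close> to a
  neighbourhood, because \<open>S_Lag\<close> is uncontrolled where the data are not smooth, but it
  covers all \<open>q\<close>.\<close>

locale generalized_equation =
  fixes \<Phi> :: "'z::euclidean_space \<times> 'w::real_normed_vector \<Rightarrow> 'z"
    and D :: "'z \<times> 'w \<Rightarrow> 'z" and T :: "'z \<Rightarrow> 'z"
    and \<Gamma> :: "('z \<times> 'z) set" and J :: "'z \<Rightarrow> 'z" and S :: "'w \<times> 'z \<Rightarrow> 'z set"
    and zb :: 'z and wb :: 'w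
  assumes strict: "has_strict_derivative \<Phi> D (zb, wb)"
    and T_def: "T = adjoint (\<lambda>h. D (h, 0))"
    and \<Gamma>_closed: "closed \<Gamma>"
    and J: "orthogonal_transformation J"
    and local_solutions: "\<forall>\<^sub>F (z, w) in nhds (zb, wb). \<forall>q. z \<in> S (w, q) \<longleftrightarrow> (z, J q - \<Phi> (z, w)) \<in> \<Gamma>"
    and base: "(zb, - \<Phi> (zb, wb)) \<in> \<Gamma>"
begin

lemma D_linear: "linear (\<lambda>h. D (h, 0))"
proof -
  have "linear (\<lambda>h::'z. (h, 0::'w))"
    by (intro bounded_linear.linear bounded_linear_Pair bounded_linear_ident bounded_linear_zero)
  moreover have "linear D"
    using strict by (simp add: has_strict_derivative_def bounded_linear.linear)
  ultimately show ?thesis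
    using linear_compose by (fastforce simp: o_def)
qed

lemma T_inner: "T \<eta> \<bullet> h = \<eta> \<bullet> D (h, 0)"
  unfolding T_def using adjoint_works[OF D_linear] by (simp add: inner_commute)

lemma T_linear: "linear T"
  unfolding T_def by (rule adjoint_linear[OF D_linear])

lemma J_props: "linear J" "norm (J q) = norm q" "J q - J q' = J (q - q')" "J 0 = 0"
  using J by (auto simp: orthogonal_transformation linear_diff linear_0)

lemma J_surj: obtains q where "J q = y" "norm q = norm y"
  using orthogonal_transformation_surj[OF J] J_props(2) by (metis surjD)

lemma neighbourhood:
  assumes "\<epsilon> > 0"
  obtains r L where "r > 0" "L > 0"
    and "\<forall>z w q. norm (z - zb) < r \<longrightarrow> norm (w - wb) < r \<longrightarrow> z \<in> S (w, q) \<longleftrightarrow> (z, J q - \<Phi> (z, w)) \<in> \<Gamma>"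
    and "\<forall>z z' w. norm (z - zb) < r \<longrightarrow> norm (z' - zb) < r \<longrightarrow> norm (w - wb) < r \<longrightarrow>
      norm (\<Phi> (z', w) - \<Phi> (z, w) - D (z' - z, 0)) \<le> \<epsilon> * norm (z' - z)"
    and "\<forall>z z' w w'. norm (z - zb) < r \<longrightarrow> norm (z' - zb) < r \<longrightarrow> norm (w - wb) < r \<longrightarrow> norm (w' - wb) < r \<longrightarrow>
      norm (\<Phi> (z', w') - \<Phi> (z, w)) \<le> L * (norm (z' - z) + norm (w' - w))"
proof -
  obtain L where L: "L > 0"
    "\<forall>\<^sub>F p in nhds ((zb, wb), (zb, wb)). norm (\<Phi> (fst p) - \<Phi> (snd p)) \<le> L * norm (fst p - snd p)"
    using has_strict_derivative_Lipschitz[OF strict] by blast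
  obtain r1 where r1: "r1 > 0"
    "\<And>p q. p \<in> ball (zb, wb) r1 \<Longrightarrow> q \<in> ball (zb, wb) r1 \<Longrightarrow> norm (\<Phi> p - \<Phi> q) \<le> L * norm (p - q)"
    using L(2) unfolding eventually_nhds_diag fst_conv snd_conv by blast
  obtain r2 where r2: "r2 > 0" "\<And>p q. norm (p - (zb, wb)) < r2 \<Longrightarrow> norm (q - (zb, wb)) < r2 \<Longrightarrow>
      norm (\<Phi> p - \<Phi> q - D (p - q)) \<le> \<epsilon> * norm (p - q)"
    using has_strict_derivative_ballD[OF strict assms] by metis
  obtain r3 where r3: "r3 > 0"
    "\<And>z w q. dist (z, w) (zb, wb) < r3 \<Longrightarrow> z \<in> S (w, q) \<longleftrightarrow> (z, J q - \<Phi> (z, w)) \<in> \<Gamma>"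
    using local_solutions unfolding eventually_nhds_metric by fastforce
  \<comment> \<open>Halved because the norm of a pair is bounded by the sum of the norms of its
    components.\<close>
  define r where "r = min r1 (min r2 r3) / 2"
  have r: "r > 0" "2 * r \<le> r1" "2 * r \<le> r2" "2 * r \<le> r3"
    using r1(1) r2(1) r3(1) by (auto simp: r_def)
  have near: "norm ((z, w) - (zb, wb)) < 2 * r" if "norm (z - zb) < r" "norm (w - wb) < r" for z w
    using norm_Pair_le[of "z - zb" "w - wb"] that by simp
  show thesis
  proof (rule that[OF r(1) L(1)]; intro allI impI)
    fix z w q assume "norm (z - zb) < r" "norm (w - wb) < r"
    from near[OF this] show "z \<in> S (w, q) \<longleftrightarrow> (z, J q - \<Phi> (z, w)) \<in> \<Gamma>"
      using r3(2) r(4) by (simp add: dist_norm)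
  next
    fix z z' w assume z: "norm (z - zb) < r" "norm (z' - zb) < r" "norm (w - wb) < r"
    show "norm (\<Phi> (z', w) - \<Phi> (z, w) - D (z' - z, 0)) \<le> \<epsilon> * norm (z' - z)"
      using r2(2)[of "(z', w)" "(z, w)"] near[OF z(1,3)] near[OF z(2,3)] r(3) by (auto simp: norm_Pair)
  next
    fix z z' w w' assume z: "norm (z - zb) < r" "norm (z' - zb) < r" "norm (w - wb) < r" "norm (w' - wb) < r"
    have "norm (\<Phi> (z', w') - \<Phi> (z, w)) \<le> L * norm ((z', w') - (z, w))"
      using r1(2)[of "(z', w')" "(z, w)"] near[OF z(1,3)] near[OF z(2,4)] r(2)
      by (simp add: dist_norm norm_minus_commute[of "(zb, wb)"] del: diff_Pair)
    also have "\<dots> \<le> L * (norm (z' - z) + norm (w' - w))"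
      using L(1) norm_Pair_le[of "z' - z" "w' - w"] by simp
    finally show "norm (\<Phi> (z', w') - \<Phi> (z, w)) \<le> L * (norm (z' - z) + norm (w' - w))" .
  qed
qed

text \<open>With \<open>e = c /\<^sub>R norm c\<close>, the residual norm has gradient close to
  \<open>(T e, e)\<close>, so at a minimizer over \<open>\<Gamma>\<close> its negative is nearly
  normal. The penalty, the quadratic remainder of the norm and the linearization of
  \<open>\<Phi>\<close> each cost \<open>\<epsilon> / 4\<close>.\<close>

lemma penalized_minimizer_eps_normal:
  assumes \<epsilon>: "\<epsilon> > 0" and c: "c = \<Phi> (z0, w) + \<zeta>0 - b" "c \<noteq> 0" and m0: "(z0, \<zeta>0) \<in> \<Gamma>"
    and r: "r > 0"
    and strict_w: "\<And>z. norm (z - z0) < r \<Longrightarrow>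
      norm (\<Phi> (z, w) - \<Phi> (z0, w) - D (z - z0, 0)) \<le> \<epsilon> / 4 * norm (z - z0)"
    and L: "L > 0" "\<And>z. norm (z - z0) < r \<Longrightarrow> norm (\<Phi> (z, w) - \<Phi> (z0, w)) \<le> L * norm (z - z0)"
    and min: "\<And>z \<zeta>. (z, \<zeta>) \<in> \<Gamma> \<Longrightarrow> norm ((z, \<zeta>) - (z0, \<zeta>0)) < r \<Longrightarrow>
      norm c \<le> norm (\<Phi> (z, w) + \<zeta> - b) + \<epsilon> / 4 * norm ((z, \<zeta>) - (z0, \<zeta>0))"
  shows "eps_normal \<epsilon> \<Gamma> (z0, \<zeta>0) (T (- (c /\<^sub>R norm c)), - (c /\<^sub>R norm c))"
  unfolding eps_normal_def
proof (intro conjI m0)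
  \<comment> \<open>The change \<open>d\<close> of the residual vector is at most
    \<open>L + 1\<close> times the displacement, so \<open>M\<close> is the coefficient of the
    quadratic remainder; the radius \<open>\<epsilon> / 4 / M\<close> reduces it to
    \<open>\<epsilon> / 4\<close> times the displacement.\<close>
  define M where "M = (L + 1)\<^sup>2 / (2 * norm c)"
  have M: "M > 0" using L(1) c(2) by (simp add: M_def)
  define e where "e = c /\<^sub>R norm c"
  have e: "norm e = 1" using c(2) by (simp add: e_def)
  show "\<exists>\<delta>>0. \<forall>p\<in>\<Gamma>. norm (p - (z0, \<zeta>0)) < \<delta> \<longrightarrow>
      (T (- (c /\<^sub>R norm c)), - (c /\<^sub>R norm c)) \<bullet> (p - (z0, \<zeta>0)) \<le> \<epsilon> * norm (p - (z0, \<zeta>0))"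
    unfolding e_def[symmetric]
  proof (intro exI[of _ "min r (\<epsilon> / 4 / M)"] conjI ballI impI)
    show "min r (\<epsilon> / 4 / M) > 0" using r \<epsilon> M by simp
    fix p assume p: "p \<in> \<Gamma>" "norm (p - (z0, \<zeta>0)) < min r (\<epsilon> / 4 / M)"
    obtain z \<zeta> where p_eq: "p = (z, \<zeta>)" by force
    let ?n = "norm (p - (z0, \<zeta>0))"
    have n: "norm (z - z0) \<le> ?n" "norm (\<zeta> - \<zeta>0) \<le> ?n"
      unfolding p_eq diff_Pair by (rule norm_fst_le norm_snd_le)+
    then have zr: "norm (z - z0) < r" using p(2) by simp
    define d where "d = \<Phi> (z, w) - \<Phi> (z0, w) + (\<zeta> - \<zeta>0)"
    have "norm d \<le> norm (\<Phi> (z, w) - \<Phi> (z0, w)) + norm (\<zeta> - \<zeta>0)"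
      unfolding d_def by (rule norm_triangle_ineq)
    also have "\<dots> \<le> L * ?n + ?n"
      using L(2)[OF zr] n L(1) by (intro add_mono) (auto intro: order_trans mult_left_mono)
    finally have "norm d \<le> (L + 1) * ?n" by (simp add: algebra_simps)
    then have "(norm d)\<^sup>2 \<le> ((L + 1) * ?n)\<^sup>2" by (intro power_mono) auto
    then have "(norm d)\<^sup>2 / (2 * norm c) \<le> ((L + 1) * ?n)\<^sup>2 / (2 * norm c)"
      by (intro divide_right_mono) auto
    also have "\<dots> = (M * ?n) * ?n"
      by (simp add: M_def power2_eq_square)
    also have "\<dots> \<le> \<epsilon> / 4 * ?n"
      using p(2) M by (intro mult_right_mono) (auto simp: field_simps)
    finally have d2: "(norm d)\<^sup>2 / (2 * norm c) \<le> \<epsilon> / 4 * ?n" .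
    have "\<Phi> (z, w) + \<zeta> - b = c + d" by (simp add: c(1) d_def)
    with min[of z \<zeta>] p p_eq have "norm c \<le> norm (c + d) + \<epsilon> / 4 * ?n" by simp
    also have "norm (c + d) \<le> norm c + e \<bullet> d + (norm d)\<^sup>2 / (2 * norm c)"
      unfolding e_def by (rule norm_add_le_linearization[OF c(2)])
    finally have 1: "- (e \<bullet> d) \<le> \<epsilon> / 2 * ?n" using d2 by simp
    have "\<bar>e \<bullet> (\<Phi> (z, w) - \<Phi> (z0, w) - D (z - z0, 0))\<bar> \<le> norm (\<Phi> (z, w) - \<Phi> (z0, w) - D (z - z0, 0))"
      using Cauchy_Schwarz_ineq2[of e "\<Phi> (z, w) - \<Phi> (z0, w) - D (z - z0, 0)"] e by simp
    also have "\<dots> \<le> \<epsilon> / 4 * ?n"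
      using strict_w[OF zr] n \<epsilon> by (auto intro: order_trans mult_left_mono)
    finally have 2: "e \<bullet> (\<Phi> (z, w) - \<Phi> (z0, w) - D (z - z0, 0)) \<le> \<epsilon> / 4 * ?n" by simp
    have "(T (- e), - e) \<bullet> (p - (z0, \<zeta>0)) = - (e \<bullet> D (z - z0, 0)) - e \<bullet> (\<zeta> - \<zeta>0)"
      by (simp add: p_eq T_inner)
    also have "\<dots> = - (e \<bullet> d) + e \<bullet> (\<Phi> (z, w) - \<Phi> (z0, w) - D (z - z0, 0))"
      by (simp add: d_def algebra_simps)
    also have "\<dots> \<le> \<epsilon> / 2 * ?n + \<epsilon> / 4 * ?n" using 1 2 by simp
    also have "\<dots> \<le> \<epsilon> * ?n" using \<epsilon> by simp
    finally show "(T (- e), - e) \<bullet> (p - (z0, \<zeta>0)) \<le> \<epsilon> * ?n" .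
  qed
qed

theorem aubin_if_injective:
  assumes inj: "\<And>\<eta>. (T \<eta>, \<eta>) \<in> limiting_normal_cone \<Gamma> (zb, - \<Phi> (zb, wb)) \<Longrightarrow> \<eta> = 0"
  shows "aubin_property S (wb, 0) zb"
proof -
  define \<zeta>b where "\<zeta>b = - \<Phi> (zb, wb)"
  define mb where "mb = (zb, \<zeta>b)"
  obtain \<epsilon> where \<epsilon>: "\<epsilon> > 0"
    "\<And>p e. norm e = 1 \<Longrightarrow> norm (p - mb) < \<epsilon> \<Longrightarrow> \<not> eps_normal \<epsilon> \<Gamma> p (T e, e)"
    using no_eps_normals[OF \<Gamma>_closed base T_linear inj] unfolding mb_def \<zeta>b_def by metis
  then have "\<epsilon> / 4 > 0" by simp
  then obtain r0 L where r0: "r0 > 0" "L > 0" and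
    nb0: "\<forall>z w q. norm (z - zb) < r0 \<longrightarrow> norm (w - wb) < r0 \<longrightarrow> z \<in> S (w, q) \<longleftrightarrow> (z, J q - \<Phi> (z, w)) \<in> \<Gamma>"
    "\<forall>z z' w. norm (z - zb) < r0 \<longrightarrow> norm (z' - zb) < r0 \<longrightarrow> norm (w - wb) < r0 \<longrightarrow>
      norm (\<Phi> (z', w) - \<Phi> (z, w) - D (z' - z, 0)) \<le> \<epsilon> / 4 * norm (z' - z)"
    "\<forall>z z' w w'. norm (z - zb) < r0 \<longrightarrow> norm (z' - zb) < r0 \<longrightarrow> norm (w - wb) < r0 \<longrightarrow> norm (w' - wb) < r0 \<longrightarrow>
      norm (\<Phi> (z', w') - \<Phi> (z, w)) \<le> L * (norm (z' - z) + norm (w' - w))"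
    by (rule neighbourhood)
  note nb = nb0[rule_format]
  \<comment> \<open>Within \<open>\<rho>\<close> of \<open>mb\<close> both the local estimates and
    the exclusion of approximate normals apply.\<close>
  define \<rho> where "\<rho> = min r0 \<epsilon> / 2"
  have \<rho>: "\<rho> > 0" "\<rho> < r0" "\<rho> < \<epsilon>" using r0 \<epsilon> by (auto simp: \<rho>_def)
  \<comment> \<open>The penalty slope \<open>\<epsilon> / 4\<close> converts the initial residual,
    at most \<open>(L + 1) * norm (p' - p)\<close>, into a bound on the distance to the
    minimizer.\<close>
  define \<kappa> where "\<kappa> = (L + 1) * 4 / \<epsilon>"
  have \<kappa>: "\<kappa> > 0" using r0 \<epsilon> by (simp add: \<kappa>_def)
  \<comment> \<open>Half of \<open>\<rho>\<close> is reserved for the distance of the lifted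
    solution \<open>m\<close> from \<open>mb\<close> (fact \<open>s1\<close>), the other half for
    the move from \<open>m\<close> to the minimizer (fact \<open>s2\<close>).\<close>
  define s where "s = \<rho> / (4 * (1 + L + \<kappa>))"
  have s: "s > 0" and s4: "s * (4 * (1 + L + \<kappa>)) = \<rho>"
    using \<rho> \<kappa> r0 by (auto simp: s_def)
  have "s * 1 < s * (4 * (1 + L + \<kappa>))"
    using s \<kappa> r0 by (intro mult_strict_left_mono) auto
  with s s4 have s: "s > 0" "s < \<rho>" by simp_all
  have s1: "s * (2 * (1 + L)) \<le> \<rho> / 2" and s2: "s * (2 * \<kappa>) < \<rho> / 2"
    using s4 s(1) \<kappa> r0 by (auto simp: algebra_simps add_pos_pos)
  have "\<exists>z'\<in>S p'. norm (z - z') \<le> \<kappa> * norm (p' - p)"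
    if p: "p \<in> ball (wb, 0) s" "p' \<in> ball (wb, 0) s" and z: "z \<in> S p \<inter> ball zb s" for p p' z
  proof -
    obtain w q w' q' where pq: "p = (w, q)" "p' = (w', q')" by force
    let ?n = "norm (p' - p)"
    have n: "norm (w' - w) \<le> ?n" "norm (q' - q) \<le> ?n" "?n < 2 * s"
    proof -
      show "norm (w' - w) \<le> ?n" "norm (q' - q) \<le> ?n"
        unfolding pq diff_Pair by (rule norm_fst_le norm_snd_le)+
      have "dist p' p < s + s"
        using p by (intro dist_triangle_less_add[of p' "(wb, 0)" s p s]) (simp_all add: dist_commute)
      then show "?n < 2 * s" by (simp add: dist_norm)
    qed
    have ws: "norm (w - wb) < s" "norm (w' - wb) < s" "norm q < s" "norm (z - zb) < s"
      using p z dist_fst_le[of "(wb, 0)" p] dist_fst_le[of "(wb, 0)" p'] dist_snd_le[of "(wb, 0)" p]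
      by (auto simp: pq dist_norm norm_minus_commute simp del: diff_Pair)
    have wr: "norm (w - wb) < r0" "norm (w' - wb) < r0" "norm (z - zb) < r0"
      using ws s \<rho> by auto
    define \<zeta> where "\<zeta> = J q - \<Phi> (z, w)"
    define m where "m = (z, \<zeta>)"
    have m\<Gamma>: "m \<in> \<Gamma>"
      using z nb(1)[OF wr(3,1)] by (simp add: m_def \<zeta>_def pq)
    have "\<zeta> - \<zeta>b = J q - (\<Phi> (z, w) - \<Phi> (zb, wb))" by (simp add: \<zeta>_def \<zeta>b_def)
    then have "norm (\<zeta> - \<zeta>b) \<le> norm (J q) + norm (\<Phi> (z, w) - \<Phi> (zb, wb))"
      by (metis norm_triangle_ineq4)
    also have "\<dots> \<le> s + L * (s + s)"
      using nb(3)[of zb z wb w] wr r0 ws J_props(2)[of q]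
      by (intro add_mono) (auto intro: order_trans mult_left_mono)
    finally have "norm (\<zeta> - \<zeta>b) \<le> s + L * (s + s)" .
    then have "norm (m - mb) < s + (s + L * (s + s))"
      using norm_Pair_le[of "z - zb" "\<zeta> - \<zeta>b"] ws(4) by (simp add: m_def mb_def)
    also have "\<dots> = s * (2 * (1 + L))" by (simp add: algebra_simps)
    finally have mmb: "norm (m - mb) < \<rho> / 2" using s1 by simp
    define \<phi> where "\<phi> p = norm (\<Phi> (fst p, w') + snd p - J q')" for p
    have near: "norm (fst p - zb) < r0" if "norm (p - mb) \<le> \<rho>" for p
      using that \<rho> norm_fst_le[of "fst p - zb" "snd p - \<zeta>b"] by (cases p) (simp add: mb_def)
    have "continuous_on (cball zb \<rho>) (\<lambda>z. \<Phi> (z, w'))"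
    proof (rule lipschitz_on_continuous_on)
      show "L-lipschitz_on (cball zb \<rho>) (\<lambda>z. \<Phi> (z, w'))"
        using nb(3)[of _ _ w' w'] wr \<rho> r0
        by (auto intro!: lipschitz_onI simp: dist_norm norm_minus_commute)
    qed
    moreover have "fst ` (\<Gamma> \<inter> cball mb \<rho>) \<subseteq> cball zb \<rho>"
    proof
      fix x assume "x \<in> fst ` (\<Gamma> \<inter> cball mb \<rho>)"
      then obtain p where "x = fst p" "dist mb p \<le> \<rho>" by auto
      then show "x \<in> cball zb \<rho>"
        using dist_fst_le[of mb p] by (simp add: mb_def)
    qed
    ultimately have "continuous_on (\<Gamma> \<inter> cball mb \<rho>) (\<lambda>p. \<Phi> (fst p, w'))"
      by (rule continuous_on_compose2[where f = fst, OF _ continuous_on_fst[OF continuous_on_id]])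
    then have cont: "continuous_on (\<Gamma> \<inter> cball mb \<rho>) (\<lambda>p. \<phi> p + \<epsilon> / 4 * norm (p - m))"
      unfolding \<phi>_def by (intro continuous_intros)
    \<comment> \<open>The closed ball makes an exact minimizer available; \<open>m0mb\<close> shows
      afterwards that it is not on the boundary.\<close>
    have "compact (\<Gamma> \<inter> cball mb \<rho>)"
      using \<Gamma>_closed by (intro closed_Int_compact) auto
    moreover have "m \<in> \<Gamma> \<inter> cball mb \<rho>"
      using m\<Gamma> mmb \<rho> by (simp add: dist_norm norm_minus_commute)
    ultimately obtain m0 where "m0 \<in> \<Gamma> \<inter> cball mb \<rho>" and
      "\<forall>p\<in>\<Gamma> \<inter> cball mb \<rho>. \<phi> m0 + \<epsilon> / 4 * norm (m0 - m) \<le> \<phi> p + \<epsilon> / 4 * norm (p - m)"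
      using continuous_attains_inf[OF _ _ cont] by (metis empty_iff)
    then have m0: "m0 \<in> \<Gamma>" "norm (m0 - mb) \<le> \<rho>" and
      min: "\<And>p. p \<in> \<Gamma> \<Longrightarrow> norm (p - mb) \<le> \<rho> \<Longrightarrow> \<phi> m0 + \<epsilon> / 4 * norm (m0 - m) \<le> \<phi> p + \<epsilon> / 4 * norm (p - m)"
      by (simp_all add: dist_norm norm_minus_commute[of mb])
    \<comment> \<open>The residual of \<open>m\<close> vanishes at the old parameter, so at the new
      one only the changes of \<open>\<Phi>\<close> in \<open>w\<close> and of \<open>J q\<close>
      remain.\<close>
    have "\<phi> m = norm ((\<Phi> (z, w') - \<Phi> (z, w)) - (J q' - J q))"
      by (simp add: \<phi>_def m_def \<zeta>_def algebra_simps)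
    also have "\<dots> \<le> norm (\<Phi> (z, w') - \<Phi> (z, w)) + norm (J (q' - q))"
      unfolding J_props(3) by (rule norm_triangle_ineq4)
    also have "\<dots> \<le> L * ?n + ?n"
      using nb(3)[of z z w w'] wr n r0 J_props(2)[of "q' - q"]
      by (intro add_mono) (auto intro: order_trans mult_left_mono)
    finally have \<phi>m: "\<phi> m \<le> (L + 1) * ?n" by (simp add: algebra_simps)
    have \<phi>0: "\<phi> m0 \<ge> 0" by (simp add: \<phi>_def)
    have "\<epsilon> / 4 * norm (m0 - m) \<le> (L + 1) * ?n"
      using min[OF m\<Gamma>] mmb \<phi>m \<phi>0 \<rho>(1) by simp
    then have m0m: "norm (m0 - m) \<le> \<kappa> * ?n"
      using \<epsilon> by (simp add: \<kappa>_def field_simps)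
    also have "\<dots> \<le> s * (2 * \<kappa>)"
      using n(3) \<kappa> by simp
    finally have m0mb: "norm (m0 - mb) < \<rho>"
      using s2 mmb norm_triangle_ineq[of "m0 - m" "m - mb"] by simp
    obtain z0 \<zeta>0 where m0_eq: "m0 = (z0, \<zeta>0)" by force
    have z0r: "norm (z0 - zb) < r0" using near[OF m0(2)] by (simp add: m0_eq)
    define c where "c = \<Phi> (z0, w') + \<zeta>0 - J q'"
    have "c = 0"
    proof (rule ccontr)
      assume "c \<noteq> 0"
      \<comment> \<open>Within this distance of \<open>m0\<close> the ball constraint is inactive,
        so \<open>m0\<close> competes with all nearby points of \<open>\<Gamma>\<close>.\<close>
      define r where "r = \<rho> - norm (m0 - mb)"
      have r: "r > 0" using m0mb by (simp add: r_def)
      have rr: "norm (p - mb) \<le> \<rho>" if "norm (p - m0) < r" for p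
        using that norm_triangle_ineq[of "p - m0" "m0 - mb"] by (simp add: r_def)
      have rz: "norm (z - zb) < r0" if "norm (z - z0) < r" for z
        using near[OF rr[of "(z, \<zeta>0)"]] that by (simp add: m0_eq norm_Pair)
      have "eps_normal \<epsilon> \<Gamma> (z0, \<zeta>0) (T (- (c /\<^sub>R norm c)), - (c /\<^sub>R norm c))"
      proof (rule penalized_minimizer_eps_normal[OF \<epsilon>(1) c_def \<open>c \<noteq> 0\<close> _ r _ r0(2)])
        show "(z0, \<zeta>0) \<in> \<Gamma>" using m0 m0_eq by simp
        fix z assume "norm (z - z0) < r"
        then show "norm (\<Phi> (z, w') - \<Phi> (z0, w') - D (z - z0, 0)) \<le> \<epsilon> / 4 * norm (z - z0)"
          and "norm (\<Phi> (z, w') - \<Phi> (z0, w')) \<le> L * norm (z - z0)"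
          using nb(2)[OF z0r rz wr(2)] nb(3)[OF z0r rz wr(2) wr(2)] by auto
      next
        fix z \<zeta> assume z\<zeta>: "(z, \<zeta>) \<in> \<Gamma>" "norm ((z, \<zeta>) - (z0, \<zeta>0)) < r"
        have "norm c + \<epsilon> / 4 * norm (m0 - m) \<le> \<phi> (z, \<zeta>) + \<epsilon> / 4 * norm ((z, \<zeta>) - m)"
          using min[OF z\<zeta>(1) rr] z\<zeta>(2) by (simp add: c_def \<phi>_def m0_eq)
        \<comment> \<open>Recenters the penalty from \<open>m\<close> to the minimizer, as
          \<open>penalized_minimizer_eps_normal\<close> requires.\<close>
        moreover have "\<epsilon> / 4 * norm ((z, \<zeta>) - m) \<le> \<epsilon> / 4 * (norm ((z, \<zeta>) - m0) + norm (m0 - m))"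
          using \<epsilon>(1) norm_triangle_ineq[of "(z, \<zeta>) - m0" "m0 - m"] by (intro mult_left_mono) auto
        ultimately show "norm c \<le> norm (\<Phi> (z, w') + \<zeta> - J q') + \<epsilon> / 4 * norm ((z, \<zeta>) - (z0, \<zeta>0))"
          by (simp add: \<phi>_def m0_eq algebra_simps)
      qed
      moreover have "norm (- (c /\<^sub>R norm c)) = 1" using \<open>c \<noteq> 0\<close> by simp
      moreover have "norm ((z0, \<zeta>0) - mb) < \<epsilon>" using m0mb \<rho>(3) m0_eq by simp
      ultimately show False using \<epsilon>(2) by blast
    qed
    then have "J q' - \<Phi> (z0, w') = \<zeta>0" by (simp add: c_def algebra_simps)
    then have "z0 \<in> S p'"
      using nb(1)[OF z0r wr(2)] m0(1) m0_eq pq(2) by simp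
    moreover have "norm (z - z0) \<le> \<kappa> * ?n"
      using m0m norm_fst_le[of "z0 - z" "\<zeta>0 - \<zeta>"] by (simp add: m0_eq m_def norm_minus_commute)
    ultimately show ?thesis by blast
  qed
  moreover have "zb \<in> S (wb, 0)"
    using nb(1)[of zb wb 0] r0(1) base by (simp add: J_props)
  ultimately show ?thesis
    unfolding aubin_property_iff using s(1) \<kappa>
    by (intro conjI exI[of _ "ball (wb, 0) s"] exI[of _ "ball zb s"] exI[of _ \<kappa>]) auto
qed

text \<open>Perturbing by a multiple \<open>d\<close> of \<open>b\<close> gives
  \<open>b \<bullet> d = \<tau> * norm b\<close>. In the test of \<open>(a, b)\<close> against the
  resulting displacement, \<open>a\<close> is close to \<open>T b\<close> and cancels the linear
  part of the change of \<open>\<Phi>\<close>; whatever remains carries a factor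
  \<open>\<epsilon>\<close>.\<close>

lemma regular_normal_bound:
  assumes reg: "(a, b) \<in> regular_normal_cone \<Gamma> (z, \<zeta>)"
    and \<epsilon>: "\<epsilon> > 0" and r: "r > 0" and \<kappa>: "\<kappa> > 0" and L: "L > 0"
    and a: "norm (a - T b) \<le> \<epsilon>"
    and strict_z: "\<And>z'. norm (z' - z) < r \<Longrightarrow>
      norm (\<Phi> (z', wb) - \<Phi> (z, wb) - D (z' - z, 0)) \<le> \<epsilon> * norm (z' - z)"
    and L_z: "\<And>z'. norm (z' - z) < r \<Longrightarrow> norm (\<Phi> (z', wb) - \<Phi> (z, wb)) \<le> L * norm (z' - z)"
    and sol: "\<And>d. norm d < r \<Longrightarrow>
      \<exists>z'. norm (z' - z) \<le> \<kappa> * norm d \<and> (z', \<zeta> + d - (\<Phi> (z', wb) - \<Phi> (z, wb))) \<in> \<Gamma>"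
  shows "norm b \<le> \<epsilon> * (\<kappa> * (2 + norm b) + 1 + L * \<kappa>)"
proof (cases "b = 0")
  case True
  with \<epsilon> \<kappa> L show ?thesis by simp
next
  case False
  obtain \<delta> where \<delta>: "\<delta> > 0" "\<And>p. p \<in> \<Gamma> \<Longrightarrow> norm (p - (z, \<zeta>)) < \<delta> \<Longrightarrow>
      (a, b) \<bullet> (p - (z, \<zeta>)) \<le> \<epsilon> * norm (p - (z, \<zeta>))"
    using reg \<epsilon> unfolding regular_normal_cone_iff_eps eps_normal_def by blast
  \<comment> \<open>\<open>C * \<tau>\<close> bounds the displacement in \<open>\<Gamma>\<close>:
    \<open>\<kappa>\<close> accounts for \<open>z\<close>, and \<open>1 + L * \<kappa>\<close> for
    the second component.\<close>
  define C where "C = 1 + \<kappa> + L * \<kappa>"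
  have C: "C \<ge> 1" "C \<ge> \<kappa>" using \<kappa> L by (auto simp: C_def)
  \<comment> \<open>\<open>\<delta>\<close> belongs to the individual normal, yet it does not enter
    the conclusion: the final estimate is divided by \<open>\<tau>\<close>.\<close>
  define \<tau> where "\<tau> = min r \<delta> / (2 * C)"
  have \<tau>: "\<tau> > 0" and \<tau>C: "C * \<tau> < r" "C * \<tau> < \<delta>"
    using r \<delta>(1) C by (auto simp: \<tau>_def)
  define t where "t = \<tau> / norm b"
  have t: "t > 0" using \<tau> False by (simp add: t_def)
  define d where "d = t *\<^sub>R b"
  have d: "norm d = \<tau>" using t False by (simp add: d_def) (simp add: t_def)
  have "1 * \<tau> \<le> C * \<tau>" using C \<tau> by (intro mult_right_mono) auto
  then have "norm d < r" using \<tau>C d by simp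
  from sol[OF this] obtain z' where z': "norm (z' - z) \<le> \<kappa> * \<tau>"
    "(z', \<zeta> + d - (\<Phi> (z', wb) - \<Phi> (z, wb))) \<in> \<Gamma>"
    unfolding d by blast
  have "\<kappa> * \<tau> \<le> C * \<tau>" using C \<tau> by (intro mult_right_mono) auto
  then have z'r: "norm (z' - z) < r" using z'(1) \<tau>C by simp
  let ?e = "\<Phi> (z', wb) - \<Phi> (z, wb)"
  have "norm ?e \<le> L * (\<kappa> * \<tau>)"
    using L_z[OF z'r] z'(1) L by (auto intro: order_trans mult_left_mono)
  then have \<zeta>': "norm (d - ?e) \<le> (1 + L * \<kappa>) * \<tau>"
    using norm_triangle_ineq4[of d ?e] d by (simp add: algebra_simps)
  let ?p = "(z', \<zeta> + d - ?e)"
  have p: "?p - (z, \<zeta>) = (z' - z, d - ?e)" by simp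
  have np: "norm (?p - (z, \<zeta>)) \<le> C * \<tau>"
    unfolding p using norm_Pair_le[of "z' - z" "d - ?e"] \<zeta>' z'(1) by (simp add: C_def algebra_simps)
  have "(a, b) \<bullet> (?p - (z, \<zeta>)) \<le> \<epsilon> * (C * \<tau>)"
    using \<delta>(2)[OF z'(2)] np \<tau>C \<epsilon> by (auto intro: order_trans mult_left_mono)
  then have 1: "a \<bullet> (z' - z) + b \<bullet> (d - ?e) \<le> \<epsilon> * (C * \<tau>)"
    unfolding p by simp
  have "- ((a - T b) \<bullet> (z' - z)) \<le> norm (a - T b) * norm (z' - z)"
    using Cauchy_Schwarz_ineq2[of "a - T b" "z' - z"] by linarith
  also have "\<dots> \<le> \<epsilon> * (\<kappa> * \<tau>)"
    using a z'(1) \<epsilon> by (intro mult_mono) auto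
  finally have 2: "- ((a - T b) \<bullet> (z' - z)) \<le> \<epsilon> * (\<kappa> * \<tau>)" .
  have "b \<bullet> (?e - D (z' - z, 0)) \<le> norm b * norm (?e - D (z' - z, 0))"
    by (rule norm_cauchy_schwarz)
  also have "\<dots> \<le> norm b * (\<epsilon> * (\<kappa> * \<tau>))"
    using strict_z[OF z'r] z'(1) \<epsilon> by (intro mult_left_mono) (auto intro: order_trans mult_left_mono)
  finally have 3: "b \<bullet> (?e - D (z' - z, 0)) \<le> norm b * (\<epsilon> * (\<kappa> * \<tau>))" .
  have "\<tau> * norm b = b \<bullet> d"
    using False by (simp add: d_def t_def power2_norm_eq_inner[symmetric] power2_eq_square)
  \<comment> \<open>With \<open>T b \<bullet> (z' - z) = b \<bullet> D (z' - z, 0)\<close>, the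
    three parts are the tested pairing, the defect of \<open>a\<close> from \<open>T b\<close>, and
    the linearization error.\<close>
  also have "b \<bullet> d = (a \<bullet> (z' - z) + b \<bullet> (d - ?e)) - (a - T b) \<bullet> (z' - z) + b \<bullet> (?e - D (z' - z, 0))"
    unfolding inner_diff_left[of a "T b"] T_inner inner_diff_right[of b d]
      inner_diff_right[of b ?e] by simp
  also have "\<dots> \<le> \<epsilon> * (C * \<tau>) + \<epsilon> * (\<kappa> * \<tau>) + norm b * (\<epsilon> * (\<kappa> * \<tau>))"
    using 1 2 3 by linarith
  also have "\<dots> = \<tau> * (\<epsilon> * (\<kappa> * (2 + norm b) + 1 + L * \<kappa>))"
    by (simp add: C_def algebra_simps)
  finally show ?thesis using \<tau> by simp
qed

theorem injective_if_aubin: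
  assumes aubin: "aubin_property S (wb, 0) zb"
    and \<eta>: "(T \<eta>, \<eta>) \<in> limiting_normal_cone \<Gamma> (zb, - \<Phi> (zb, wb))"
  shows "\<eta> = 0"
proof -
  define \<zeta>b where "\<zeta>b = - \<Phi> (zb, wb)"
  obtain U V \<kappa> where U: "open U" "(wb, 0) \<in> U" and V: "open V" "zb \<in> V" and \<kappa>: "\<kappa> > 0" and
    lip0: "\<forall>p\<in>U. \<forall>p'\<in>U. \<forall>z\<in>S p \<inter> V. \<exists>s\<in>S p'. norm (z - s) \<le> \<kappa> * norm (p' - p)"
    using aubin unfolding aubin_property_iff by (elim conjE exE) (rule that)
  note lip = lip0[rule_format]
  obtain s1 where s1: "s1 > 0" "ball (wb, 0) s1 \<subseteq> U"
    using openE[OF U] by metis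
  obtain s2 where s2: "s2 > 0" "ball zb s2 \<subseteq> V"
    using openE[OF V] by metis
  obtain ps qs where lim: "ps \<longlonglongrightarrow> (zb, \<zeta>b)" "qs \<longlonglongrightarrow> (T \<eta>, \<eta>)" and
    reg: "\<forall>k::nat. qs k \<in> regular_normal_cone \<Gamma> (ps k)"
    using \<eta> unfolding limiting_normal_cone_def \<zeta>b_def by blast
  \<comment> \<open>\<open>L\<close> is fixed before \<open>\<epsilon>\<close>:
    \<open>neighbourhood\<close> does not state that its constant is independent of
    \<open>\<epsilon>\<close>, and the final limit relies on that.\<close>
  obtain r1 L where rL: "r1 > 0" "L > 0" and
    Lip: "\<forall>z z' w w'. norm (z - zb) < r1 \<longrightarrow> norm (z' - zb) < r1 \<longrightarrow> norm (w - wb) < r1 \<longrightarrow> norm (w' - wb) < r1 \<longrightarrow>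
      norm (\<Phi> (z', w') - \<Phi> (z, w)) \<le> L * (norm (z' - z) + norm (w' - w))"
    by (rule neighbourhood[OF zero_less_one]) (rule that)
  have key: "norm \<eta> \<le> \<epsilon> * (\<kappa> * (2 + norm \<eta>) + 1 + L * \<kappa>)" if \<epsilon>: "\<epsilon> > 0" for \<epsilon>
  proof -
    from \<epsilon> obtain r2 where r2: "r2 > 0" and
      nb0: "\<forall>z w q. norm (z - zb) < r2 \<longrightarrow> norm (w - wb) < r2 \<longrightarrow> z \<in> S (w, q) \<longleftrightarrow> (z, J q - \<Phi> (z, w)) \<in> \<Gamma>"
      "\<forall>z z' w. norm (z - zb) < r2 \<longrightarrow> norm (z' - zb) < r2 \<longrightarrow> norm (w - wb) < r2 \<longrightarrow>
        norm (\<Phi> (z', w) - \<Phi> (z, w) - D (z' - z, 0)) \<le> \<epsilon> * norm (z' - z)"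
      by (rule neighbourhood) (rule that)
    note nb = nb0[rule_format] Lip[rule_format]
    define r0 where "r0 = min (min r1 r2) (min s1 s2) / 2"
    have r0: "r0 > 0" "2 * r0 \<le> r1" "2 * r0 \<le> r2" "2 * r0 \<le> s1" "2 * r0 \<le> s2"
      using rL r2 s1 s2 by (auto simp: r0_def)
    \<comment> \<open>Keeps both the perturbation \<open>d\<close> and the displacement of the
      solution, at most \<open>\<kappa> * norm d\<close>, within \<open>r0\<close>.\<close>
    define r where "r = r0 / (1 + \<kappa>)"
    have r: "r > 0" "r \<le> r0" "\<kappa> * r \<le> r0"
      using r0 \<kappa> by (auto simp: r_def field_simps)
    \<comment> \<open>Makes the parameter \<open>q\<close> belonging to a graph point within
      \<open>\<sigma>\<close> of the base smaller than
      \<open>\<sigma> + L * \<sigma> = r0\<close>.\<close>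
    define \<sigma> where "\<sigma> = r0 / (1 + L)"
    have \<sigma>0: "\<sigma> > 0" using r0 rL by (simp add: \<sigma>_def)
    have "(1 + L) * \<sigma> = r0" using rL by (simp add: \<sigma>_def)
    then have \<sigma>1: "\<sigma> + L * \<sigma> = r0" by (simp add: distrib_right)
    have "0 \<le> L * \<sigma>" using \<sigma>0 rL by simp
    with \<sigma>0 \<sigma>1 have \<sigma>: "\<sigma> > 0" "\<sigma> + L * \<sigma> = r0" "\<sigma> \<le> r0" by linarith+
    have bound: "norm (snd (qs k)) \<le> \<epsilon> * (\<kappa> * (2 + norm (snd (qs k))) + 1 + L * \<kappa>)"
      if k: "dist (ps k) (zb, \<zeta>b) < \<sigma>" "norm (fst (qs k) - T (snd (qs k))) < \<epsilon>" for k
    proof -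
      obtain z \<zeta> a b where eq: "ps k = (z, \<zeta>)" "qs k = (a, b)" by force
      have near: "norm (z - zb) < \<sigma>" "norm (\<zeta> - \<zeta>b) < \<sigma>"
        using k(1) dist_fst_le[of "ps k" "(zb, \<zeta>b)"] dist_snd_le[of "ps k" "(zb, \<zeta>b)"]
        by (auto simp: eq dist_norm simp del: diff_Pair)
      then have zr0: "norm (z - zb) < r0" using \<sigma> by simp
      have near': "norm (z' - zb) < 2 * r0" if "norm (z' - z) < r0" for z'
        using that zr0 norm_triangle_ineq[of "z' - z" "z - zb"] by simp
      \<comment> \<open>Surjectivity of \<open>J\<close> makes the graph point carrying the regular
        normal a solution at \<open>(wb, q)\<close>, so the Aubin property can be applied
        there.\<close>
      obtain q where q: "J q = \<zeta> + \<Phi> (z, wb)" by (rule J_surj)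
      have "norm q = norm (\<zeta> - \<zeta>b + (\<Phi> (z, wb) - \<Phi> (zb, wb)))"
        using J_props(2)[of q] q by (simp add: \<zeta>b_def)
      also have "\<dots> \<le> norm (\<zeta> - \<zeta>b) + norm (\<Phi> (z, wb) - \<Phi> (zb, wb))"
        by (rule norm_triangle_ineq)
      also have "norm (\<Phi> (z, wb) - \<Phi> (zb, wb)) \<le> L * norm (z - zb)"
        using nb(3)[of zb z wb wb] rL zr0 r0 by simp
      also have "\<dots> \<le> L * \<sigma>" using near rL by simp
      finally have qr0: "norm q < r0" using near(2) \<sigma>(2) by simp
      have "ps k \<in> \<Gamma>" using reg by (simp add: regular_normal_cone_def)
      then have zS: "z \<in> S (wb, q)"
        using nb(1)[of z wb q] zr0 r0 r2 by (simp add: q eq)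
      have wbq: "(wb, q') \<in> U" if "norm q' < 2 * r0" for q'
        using that r0 by (intro subsetD[OF s1(2)]) (simp add: dist_Pair_Pair)
      have "norm b \<le> \<epsilon> * (\<kappa> * (2 + norm b) + 1 + L * \<kappa>)"
      proof (rule regular_normal_bound[OF _ \<epsilon> r(1) \<kappa> rL(2)])
        show "(a, b) \<in> regular_normal_cone \<Gamma> (z, \<zeta>)" using reg[rule_format, of k] by (simp add: eq)
        show "norm (a - T b) \<le> \<epsilon>" using k(2) by (simp add: eq)
      next
        fix z' assume "norm (z' - z) < r"
        then have "norm (z' - zb) < 2 * r0" using r near' by simp
        then show "norm (\<Phi> (z', wb) - \<Phi> (z, wb) - D (z' - z, 0)) \<le> \<epsilon> * norm (z' - z)"
          and "norm (\<Phi> (z', wb) - \<Phi> (z, wb)) \<le> L * norm (z' - z)"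
          using nb(2)[of z z' wb] nb(3)[of z z' wb wb] zr0 r0 r2 rL by auto
      next
        fix d :: 'z assume d: "norm d < r"
        obtain q' where q': "J q' = d" "norm q' = norm d" by (rule J_surj)
        have "norm (q + q') < 2 * r0"
          using norm_triangle_ineq[of q q'] qr0 d q' r by simp
        then have "(wb, q + q') \<in> U" "(wb, q) \<in> U" using qr0 r0 by (auto intro!: wbq)
        moreover have "z \<in> V" using zr0 r0 by (intro subsetD[OF s2(2)]) (simp add: dist_norm norm_minus_commute)
        ultimately obtain z' where z': "z' \<in> S (wb, q + q')" "norm (z - z') \<le> \<kappa> * norm ((wb, q + q') - (wb, q))"
          using lip[of "(wb, q)" "(wb, q + q')" z] zS by blast
        have le: "norm (z' - z) \<le> \<kappa> * norm d"
          using z'(2) q'(2) by (simp add: norm_minus_commute norm_Pair)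
        also have "\<dots> < \<kappa> * r" using d \<kappa> by simp
        finally have "norm (z' - zb) < 2 * r0" using r near' by simp
        then have "(z', J (q + q') - \<Phi> (z', wb)) \<in> \<Gamma>"
          using nb(1)[of z' wb "q + q'"] r0 r2 z'(1) by simp
        moreover have "J (q + q') - \<Phi> (z', wb) = \<zeta> + d - (\<Phi> (z', wb) - \<Phi> (z, wb))"
          using linear_add[OF J_props(1), of q q'] q q' by simp
        ultimately show "\<exists>z'. norm (z' - z) \<le> \<kappa> * norm d \<and> (z', \<zeta> + d - (\<Phi> (z', wb) - \<Phi> (z, wb))) \<in> \<Gamma>"
          using le by auto
      qed
      then show ?thesis by (simp add: eq)
    qed
    note lim2 = tendsto_fst[OF lim(2), unfolded fst_conv] tendsto_snd[OF lim(2), unfolded snd_conv]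
    have "(\<lambda>k. fst (qs k) - T (snd (qs k))) \<longlonglongrightarrow> T \<eta> - T \<eta>"
      using bounded_linear.tendsto[OF T_linear[unfolded linear_conv_bounded_linear] lim2(2)]
      by (intro tendsto_diff lim2)
    then have "\<forall>\<^sub>F k in sequentially. norm (fst (qs k) - T (snd (qs k))) < \<epsilon>"
      using \<epsilon> by (auto simp: tendsto_iff dist_norm)
    moreover have "\<forall>\<^sub>F k in sequentially. dist (ps k) (zb, \<zeta>b) < \<sigma>"
      using lim(1) \<sigma>(1) by (simp add: tendsto_iff)
    ultimately have ev: "\<forall>\<^sub>F k in sequentially.
        norm (snd (qs k)) \<le> \<epsilon> * (\<kappa> * (2 + norm (snd (qs k))) + 1 + L * \<kappa>)"
      by eventually_elim (rule bound)
    show ?thesis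
      by (rule tendsto_le[OF _ _ _ ev]) (auto intro!: tendsto_intros lim2)
  qed
  \<comment> \<open>The bound now concerns the limit \<open>\<eta>\<close> itself, and its other
    factor does not depend on \<open>\<epsilon>\<close>.\<close>
  have "((\<lambda>\<epsilon>. \<epsilon> * (\<kappa> * (2 + norm \<eta>) + 1 + L * \<kappa>)) \<longlongrightarrow> 0 * (\<kappa> * (2 + norm \<eta>) + 1 + L * \<kappa>)) (at_right 0)"
    by (intro tendsto_intros)
  moreover have "\<forall>\<^sub>F \<epsilon> in at_right 0. norm \<eta> \<le> \<epsilon> * (\<kappa> * (2 + norm \<eta>) + 1 + L * \<kappa>)"
    using eventually_at_right_less[of "0::real"] by eventually_elim (rule key)
  ultimately have "norm \<eta> \<le> 0 * (\<kappa> * (2 + norm \<eta>) + 1 + L * \<kappa>)"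
    by (rule tendsto_lowerbound) simp
  then show ?thesis by simp
qed

theorem aubin_iff_injective:
  "aubin_property S (wb, 0) zb \<longleftrightarrow>
     (\<forall>\<eta>. (T \<eta>, \<eta>) \<in> limiting_normal_cone \<Gamma> (zb, - \<Phi> (zb, wb)) \<longrightarrow> \<eta> = 0)"
  using aubin_if_injective injective_if_aubin by blast

end

section \<open>Block structure\<close>

lemma orth_decompositionD:
  assumes "orth_decomposition Q"
  shows "linear (Q \<nu>)" "Q \<nu> a \<bullet> b = a \<bullet> Q \<nu> b"
    "Q \<nu> (Q \<mu> a) = (if \<nu> = \<mu> then Q \<mu> a else 0)" "(\<Sum>\<nu>\<in>UNIV. Q \<nu> a) = a"
  using assms unfolding orth_decomposition_def by blast+

lemma orth_decomposition_range_iff: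
  assumes "orth_decomposition Q"
  shows "a \<in> range (Q \<nu>) \<longleftrightarrow> Q \<nu> a = a"
  using orth_decompositionD(3)[OF assms, of \<nu> \<nu>] by (auto simp: image_iff) (metis+)

lemma orth_decomposition_sum_blocks:
  fixes Q :: "'p::finite \<Rightarrow> 'y::euclidean_space \<Rightarrow> 'y"
  assumes "orth_decomposition Q"
  shows "Q \<nu> (\<Sum>\<mu>\<in>UNIV. Q \<mu> (a \<mu>)) = Q \<nu> (a \<nu>)"
  by (simp add: linear_sum[OF orth_decompositionD(1)[OF assms]] orth_decompositionD(3)[OF assms])

lemma orth_decomposition_xblk:
  fixes own :: "'n::finite \<Rightarrow> 'p::finite"
  shows "orth_decomposition (xblk own)"
  unfolding orth_decomposition_def
proof (intro conjI allI)
  fix \<nu> \<mu> and a b :: "real ^ 'n"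
  show "linear (xblk own \<nu>)"
    by (rule linearI) (auto simp: xblk_def vec_eq_iff)
  show "xblk own \<nu> a \<bullet> b = a \<bullet> xblk own \<nu> b"
    unfolding inner_vec_def by (intro sum.cong) (auto simp: xblk_def)
  show "xblk own \<nu> (xblk own \<mu> a) = (if \<nu> = \<mu> then xblk own \<mu> a else 0)"
    by (auto simp: xblk_def vec_eq_iff)
  show "(\<Sum>\<nu>\<in>UNIV. xblk own \<nu> a) = a"
    by (simp add: xblk_def vec_eq_iff)
qed

text \<open>Testing against points that differ from \<open>x\<close> in a single block gives the
  block conditions; conversely, the inner product splits over the orthogonal blocks.\<close>

lemma normal_cone_block_product:
  fixes Q :: "'p::finite \<Rightarrow> 'y::euclidean_space \<Rightarrow> 'y"
  assumes Q: "orth_decomposition Q" and C: "\<And>\<nu>. C \<nu> \<subseteq> range (Q \<nu>)"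
  shows "z \<in> normal_cone (block_product Q C) x \<longleftrightarrow>
    (\<forall>\<nu>. Q \<nu> z \<in> normal_cone_in (range (Q \<nu>)) (C \<nu>) (Q \<nu> x))"
proof
  assume z: "z \<in> normal_cone (block_product Q C) x"
  show "\<forall>\<nu>. Q \<nu> z \<in> normal_cone_in (range (Q \<nu>)) (C \<nu>) (Q \<nu> x)"
  proof
    fix \<nu>
    have x: "Q \<mu> x \<in> C \<mu>" for \<mu> using z by (simp add: normal_cone_in_def block_product_def)
    have "Q \<nu> z \<bullet> (c - Q \<nu> x) \<le> 0" if c: "c \<in> C \<nu>" for c
    proof -
      have Qc: "Q \<nu> c = c" using C c orth_decomposition_range_iff[OF Q] by blast
      define c' where "c' = x - Q \<nu> x + c"
      have "Q \<mu> c' = (if \<mu> = \<nu> then c else Q \<mu> x)" for \<mu>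
        using orth_decompositionD(3)[OF Q, of \<mu> \<nu> c] orth_decompositionD(3)[OF Q, of \<mu> \<nu> x] Qc
        by (simp add: c'_def linear_add[OF orth_decompositionD(1)[OF Q]]
            linear_diff[OF orth_decompositionD(1)[OF Q]])
      then have "c' \<in> block_product Q C" using x c by (simp add: block_product_def)
      then have "z \<bullet> (c' - x) \<le> 0" using z by (simp add: normal_cone_in_def)
      moreover have "Q \<nu> z \<bullet> (c - Q \<nu> x) = z \<bullet> (c' - x)"
        unfolding orth_decompositionD(2)[OF Q]
        using orth_decompositionD(3)[OF Q, of \<nu> \<nu> x] Qc
        by (simp add: c'_def linear_diff[OF orth_decompositionD(1)[OF Q]])
      ultimately show ?thesis by simp
    qed
    then show "Q \<nu> z \<in> normal_cone_in (range (Q \<nu>)) (C \<nu>) (Q \<nu> x)"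
      using x by (simp add: normal_cone_in_def)
  qed
next
  assume R: "\<forall>\<nu>. Q \<nu> z \<in> normal_cone_in (range (Q \<nu>)) (C \<nu>) (Q \<nu> x)"
  have "z \<bullet> (c - x) \<le> 0" if c: "c \<in> block_product Q C" for c
  proof -
    have "z \<bullet> (c - x) = (\<Sum>\<nu>\<in>UNIV. Q \<nu> z) \<bullet> (c - x)"
      by (simp add: orth_decompositionD(4)[OF Q])
    also have "\<dots> = (\<Sum>\<nu>\<in>UNIV. Q \<nu> z \<bullet> (Q \<nu> c - Q \<nu> x))"
      unfolding inner_sum_left linear_diff[OF orth_decompositionD(1)[OF Q], symmetric]
        orth_decompositionD(2)[OF Q, symmetric]
      by (simp add: orth_decompositionD(3)[OF Q])
    also have "\<dots> \<le> 0"
      using R c by (intro sum_nonpos) (simp add: normal_cone_in_def block_product_def)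
    finally show ?thesis .
  qed
  then show "z \<in> normal_cone (block_product Q C) x"
    using R by (simp add: normal_cone_in_def block_product_def)
qed

text \<open>Besides membership in \<open>C\<close>, each \<open>c\<close> in \<open>C\<close>
  contributes one inequality that is jointly continuous in the pair.\<close>

lemma closed_gph_normal_cone:
  assumes "closed C"
  shows "closed (gph (normal_cone C))"
proof -
  have "gph (normal_cone C) = fst -` C \<inter> (\<Inter>c\<in>C. {p. snd p \<bullet> (c - fst p) \<le> 0})"
    by (auto simp: gph_def normal_cone_in_def)
  moreover have "closed (fst -` C :: ('a \<times> 'a) set)"
    using assms by (rule closed_vimage_fst)
  moreover have "closed {p :: 'a \<times> 'a. snd p \<bullet> (c - fst p) \<le> 0}" for c
    by (intro closed_Collect_le continuous_intros)
  ultimately show ?thesis by (simp add: closed_Int closed_INT)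
qed

lemma closed_block_product:
  fixes Q :: "'p::finite \<Rightarrow> 'y::euclidean_space \<Rightarrow> 'y"
  assumes "orth_decomposition Q" "\<And>\<nu>. closed (C \<nu>)"
  shows "closed (block_product Q C)"
proof -
  have "block_product Q C = (\<Inter>\<nu>. Q \<nu> -` C \<nu>)" by (auto simp: block_product_def)
  moreover have "closed (Q \<nu> -` C \<nu>)" for \<nu>
    using orth_decompositionD(1)[OF assms(1)] assms(2)
    by (intro continuous_closed_vimage) (auto intro: linear_continuous_at simp: linear_conv_bounded_linear)
  ultimately show ?thesis by auto
qed

lemma closed_polar_in:
  assumes "closed E"
  shows "closed (polar_in E K)"
proof -
  have "polar_in E K = E \<inter> (\<Inter>k\<in>K. {y. y \<bullet> k \<le> 0})" by (auto simp: polar_in_def)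
  moreover have "closed {y. y \<bullet> k \<le> 0}" for k :: 'a
    by (intro closed_Collect_le continuous_intros)
  ultimately show ?thesis using assms by (simp add: closed_Int closed_INT)
qed

lemma closed_prod_rearrange:
  fixes S :: "('a::topological_space \<times> 'c::topological_space) set"
    and T :: "('b::topological_space \<times> 'd::topological_space) set"
  assumes "closed S" "closed T"
  shows "closed (prod_rearrange S T)"
proof -
  have "prod_rearrange S T =
      (\<lambda>p. (fst (fst p), fst (snd p))) -` S \<inter> (\<lambda>p. (snd (fst p), snd (snd p))) -` T"
    by (auto simp: prod_rearrange_def)
  moreover have "closed ((\<lambda>p :: ('a \<times> 'b) \<times> 'c \<times> 'd. (fst (fst p), fst (snd p))) -` S)"
    using assms(1) by (intro closed_vimage continuous_intros)
  moreover have "closed ((\<lambda>p :: ('a \<times> 'b) \<times> 'c \<times> 'd. (snd (fst p), snd (snd p))) -` T)"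
    using assms(2) by (intro closed_vimage continuous_intros)
  ultimately show ?thesis by auto
qed

section \<open>Partial gradients of the Lagrangians\<close>

lemma gradient_eq: "GDERIV h x :> g \<Longrightarrow> gradient h x = g"
  unfolding gradient_def
proof (rule the_equality)
  fix g' assume "GDERIV h x :> g" "GDERIV h x :> g'"
  then have "(\<lambda>v. v \<bullet> g) = (\<lambda>v. v \<bullet> g')"
    unfolding gderiv_def by (rule has_derivative_unique)
  then show "g' = g" by (metis inner_diff_right inner_eq_zero_iff eq_iff_diff_eq_0)
qed

text \<open>\<open>adjoint D 1\<close> is the Riesz representative of the derivative.\<close>

lemma differentiable_imp_GDERIV:
  fixes h :: "'a::euclidean_space \<Rightarrow> real"
  assumes "h differentiable (at x)"
  shows "GDERIV h x :> gradient h x"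
proof -
  obtain D where D: "(h has_derivative D) (at x)" using assms by (auto simp: differentiable_def)
  have "linear D" using D by (rule has_derivative_linear)
  then have "D = (\<lambda>v. v \<bullet> adjoint D 1)"
    using adjoint_works by (fastforce simp: inner_commute)
  then have "GDERIV h x :> adjoint D 1" using D by (simp add: gderiv_def)
  then show ?thesis using gradient_eq by metis
qed

lemma deriv_x_has_derivative:
  assumes "(\<lambda>x'. h x' w) differentiable (at x)"
  shows "((\<lambda>x'. h x' w) has_derivative blinfun_apply (deriv_x h x w)) (at x)"
proof -
  have D: "((\<lambda>x'. h x' w) has_derivative frechet_derivative (\<lambda>x'. h x' w) (at x)) (at x)"
    using assms by (simp add: frechet_derivative_works)
  then show ?thesis
    unfolding deriv_x_def
    using bounded_linear_Blinfun_apply[OF has_derivative_bounded_linear[OF D]] by simp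
qed

text \<open>The block projection is self-adjoint, so the chain rule moves it from the increment onto
  the gradient.\<close>

lemma pgradient_eq:
  fixes own :: "'n::finite \<Rightarrow> 'p::finite"
  assumes "GDERIV h x :> g"
  shows "pgradient own \<nu> h x = xblk own \<nu> g"
  unfolding pgradient_def
proof (rule gradient_eq)
  note X = orth_decompositionD[OF orth_decomposition_xblk, of own]
  have "((\<lambda>t. x + xblk own \<nu> t) has_derivative xblk own \<nu>) (at 0)"
    using X(1) by (auto intro!: derivative_eq_intros linear_imp_has_derivative)
  moreover have "(h has_derivative (\<lambda>v. v \<bullet> g)) (at (x + xblk own \<nu> 0))"
    using assms X(1) by (simp add: gderiv_def linear_0)
  ultimately have "((\<lambda>t. h (x + xblk own \<nu> t)) has_derivative (\<lambda>t. xblk own \<nu> t \<bullet> g)) (at 0)"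
    by (rule has_derivative_compose)
  then show "GDERIV (\<lambda>t. h (x + xblk own \<nu> t)) 0 :> xblk own \<nu> g"
    by (simp add: gderiv_def X(2))
qed

lemma pderivative_eq:
  fixes own :: "'n::finite \<Rightarrow> 'p::finite"
  assumes "(h has_derivative D) (at x)"
  shows "pderivative own \<nu> h x t = D (xblk own \<nu> t)"
proof -
  note X = orth_decompositionD[OF orth_decomposition_xblk, of own]
  have "((\<lambda>t. x + xblk own \<nu> t) has_derivative xblk own \<nu>) (at 0)"
    using X(1) by (auto intro!: derivative_eq_intros linear_imp_has_derivative)
  moreover have "(h has_derivative D) (at (x + xblk own \<nu> 0))"
    using assms X(1) by (simp add: linear_0)
  ultimately have "((\<lambda>t. h (x + xblk own \<nu> t)) has_derivative (\<lambda>t. D (xblk own \<nu> t))) (at 0)"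
    by (rule has_derivative_compose)
  from frechet_derivative_at[OF this, symmetric] show ?thesis by (simp add: pderivative_def)
qed

text \<open>The adjoint of \<open>T\<close>, written as a finite sum so that the product rule for
  strict derivatives applies jointly in \<open>T\<close> and \<open>y\<close>.\<close>

definition blinfun_adjoint :: "('a::euclidean_space \<Rightarrow>\<^sub>L 'b::real_inner) \<Rightarrow> 'b \<Rightarrow> 'a" where
  "blinfun_adjoint T y = (\<Sum>b\<in>Basis. (y \<bullet> blinfun_apply T b) *\<^sub>R b)"

lemma blinfun_adjoint_inner: "h \<bullet> blinfun_adjoint T y = y \<bullet> blinfun_apply T h"
proof -
  have "y \<bullet> blinfun_apply T h = y \<bullet> blinfun_apply T (\<Sum>b\<in>Basis. (h \<bullet> b) *\<^sub>R b)"
    by (simp add: euclidean_representation)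
  then show ?thesis
    by (simp add: blinfun_adjoint_def inner_sum_right blinfun.sum_right blinfun.scaleR_right mult.commute)
qed

lemma linear_blinfun_adjoint: "linear (blinfun_adjoint T)"
  unfolding blinfun_adjoint_def
  by (rule linearI) (simp_all add: inner_add_left scaleR_add_left sum.distrib scaleR_sum_right)

text \<open>The gradient in all of \<open>x\<close> of the unperturbed Lagrangian; each player's
  partial gradient is a block projection of it.\<close>

definition lagr_grad ::
  "('a::euclidean_space \<Rightarrow> 'd \<Rightarrow> real) \<Rightarrow> ('a \<Rightarrow> 'd \<Rightarrow> 'y::real_inner) \<Rightarrow> 'a \<Rightarrow> 'y \<Rightarrow> 'd \<Rightarrow> 'a" where
  "lagr_grad f F x y w = grad_x f x w + blinfun_adjoint (deriv_x F x w) y"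

lemma GDERIV_lagrangian:
  fixes own :: "'n::finite \<Rightarrow> 'p::finite"
  assumes "(\<lambda>x'. f \<nu> x' w) differentiable (at x)" "(\<lambda>x'. F \<nu> x' w) differentiable (at x)"
  shows "GDERIV (\<lambda>x'. lagrangian own f F \<nu> x' y w (xblk own \<nu> v) u) x :>
    lagr_grad (f \<nu>) (F \<nu>) x y w - xblk own \<nu> v"
proof -
  note X = orth_decompositionD[OF orth_decomposition_xblk, of own]
  have "((\<lambda>x'. f \<nu> x' w) has_derivative (\<lambda>h. h \<bullet> grad_x (f \<nu>) x w)) (at x)"
    using differentiable_imp_GDERIV[OF assms(1)] by (simp add: gderiv_def grad_x_def)
  moreover note deriv_x_has_derivative[of "F \<nu>" w x, OF assms(2)]
  moreover have "xblk own \<nu> v \<bullet> xblk own \<nu> x' = xblk own \<nu> v \<bullet> x'" for x'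
    by (simp add: X(2)[symmetric] X(3))
  ultimately have "((\<lambda>x'. lagrangian own f F \<nu> x' y w (xblk own \<nu> v) u) has_derivative
      (\<lambda>h. h \<bullet> grad_x (f \<nu>) x w - xblk own \<nu> v \<bullet> h + y \<bullet> blinfun_apply (deriv_x (F \<nu>) x w) h)) (at x)"
    unfolding lagrangian_def by (auto intro!: derivative_eq_intros)
  moreover have "h \<bullet> grad_x (f \<nu>) x w - xblk own \<nu> v \<bullet> h + y \<bullet> blinfun_apply (deriv_x (F \<nu>) x w) h =
      h \<bullet> (lagr_grad (f \<nu>) (F \<nu>) x y w - xblk own \<nu> v)" for h
    by (simp add: lagr_grad_def inner_add_right inner_diff_right blinfun_adjoint_inner inner_commute)
  ultimately show ?thesis by (simp add: gderiv_def)
qed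

lemma pgradient_lagrangian:
  fixes own :: "'n::finite \<Rightarrow> 'p::finite"
  assumes "(\<lambda>x'. f \<nu> x' w) differentiable (at x)" "(\<lambda>x'. F \<nu> x' w) differentiable (at x)"
  shows "pgradient own \<nu> (\<lambda>x'. lagrangian own f F \<nu> x' y w (xblk own \<nu> v) u) x =
    xblk own \<nu> (lagr_grad (f \<nu>) (F \<nu>) x y w) - xblk own \<nu> v"
proof -
  note X = orth_decompositionD[OF orth_decomposition_xblk, of own]
  show ?thesis
    by (simp add: pgradient_eq[OF GDERIV_lagrangian[of f \<nu> w x F own y v u]] assms linear_diff[OF X(1)] X(3))
qed

lemma pgradient_l_fun:
  fixes own :: "'n::finite \<Rightarrow> 'p::finite"
  assumes "(\<lambda>x'. f \<nu> x' w) differentiable (at x)" "(\<lambda>x'. F \<nu> x' w) differentiable (at x)"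
  shows "pgradient own \<nu> (\<lambda>x'. l_fun (\<lambda>\<nu> x. f \<nu> x w) (\<lambda>\<nu> x. F \<nu> x w) \<nu> x' y) x =
    xblk own \<nu> (lagr_grad (f \<nu>) (F \<nu>) x y w)"
  using pgradient_lagrangian[of f \<nu> w x F own y 0 0] assms
  by (simp add: lagrangian_def l_fun_def linear_0[OF orth_decompositionD(1)[OF orth_decomposition_xblk]])

text \<open>The multiplier enters bilinearly with \<open>deriv_x F\<close>, so chain and product
  rules suffice. \<open>E\<close> stays unspecified; its partial derivatives are identified later by
  uniqueness.\<close>

lemma has_strict_derivative_lagr_grad:
  assumes "strictly_differentiable_at (\<lambda>(x', w'). grad_x f x' w') (x, w)"
    and "strictly_differentiable_at (\<lambda>(x', w'). deriv_x F x' w') (x, w)"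
    and "linear p"
  obtains E where
    "has_strict_derivative (\<lambda>z. lagr_grad f F (fst (fst z)) (p (snd (fst z))) (snd z)) E ((x, y :: 'y::euclidean_space), w)"
proof -
  obtain D1 D2 where D: "has_strict_derivative (\<lambda>(x', w'). grad_x f x' w') D1 (x, w)"
    "has_strict_derivative (\<lambda>(x', w'). deriv_x F x' w') D2 (x, w)"
    using assms(1,2) unfolding strictly_differentiable_at_iff by (elim exE) (rule that)
  define \<pi> where "\<pi> = (\<lambda>z :: ('a \<times> 'y) \<times> 'b. (fst (fst z), snd z))"
  have "bounded_linear \<pi>"
    unfolding \<pi>_def
    by (intro bounded_linear_Pair bounded_linear_compose[OF bounded_linear_fst bounded_linear_fst] bounded_linear_snd)
  then have \<pi>: "has_strict_derivative \<pi> \<pi> ((x, y), w)" by (rule has_strict_derivative_linear)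
  have \<pi>z: "\<pi> ((x, y), w) = (x, w)" by (simp add: \<pi>_def)
  have "bounded_linear (\<lambda>z :: ('a \<times> 'y) \<times> 'b. p (snd (fst z)))"
    by (rule bounded_linear_compose[OF assms(3)[unfolded linear_conv_bounded_linear]
          bounded_linear_compose[OF bounded_linear_snd bounded_linear_fst]])
  then have py: "has_strict_derivative (\<lambda>z :: ('a \<times> 'y) \<times> 'b. p (snd (fst z))) (\<lambda>z. p (snd (fst z))) ((x, y), w)"
    by (rule has_strict_derivative_linear)
  have 1: "has_strict_derivative (\<lambda>z. grad_x f (fst (fst z)) (snd z)) (\<lambda>z. D1 (\<pi> z)) ((x, y), w)"
    using has_strict_derivative_compose[OF \<pi>, unfolded \<pi>z, OF D(1)] by (simp add: \<pi>_def)
  have "has_strict_derivative (\<lambda>z. deriv_x F (fst (fst z)) (snd z)) (\<lambda>z. D2 (\<pi> z)) ((x, y), w)"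
    using has_strict_derivative_compose[OF \<pi>, unfolded \<pi>z, OF D(2)] by (simp add: \<pi>_def)
  then have 2: "has_strict_derivative (\<lambda>z. blinfun_apply (deriv_x F (fst (fst z)) (snd z)) b)
      (\<lambda>z. blinfun_apply (D2 (\<pi> z)) b) ((x, y), w)" for b
    by (rule has_strict_derivative_linear_compose[rotated])
      (rule bounded_bilinear.bounded_linear_left[OF bounded_bilinear_blinfun_apply])
  have "has_strict_derivative
      (\<lambda>z. (p (snd (fst z)) \<bullet> blinfun_apply (deriv_x F (fst (fst z)) (snd z)) b) *\<^sub>R b)
      (\<lambda>z. (p (snd (fst z)) \<bullet> blinfun_apply (deriv_x F x w) b + p y \<bullet> blinfun_apply (D2 (\<pi> z)) b) *\<^sub>R b)
      ((x, y), w)" for b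
    by (rule has_strict_derivative_linear_compose[OF bounded_linear_scaleR_left
          has_strict_derivative_bilinear_compose[OF bounded_bilinear_inner py 2], unfolded fst_conv snd_conv])
  then have "has_strict_derivative
      (\<lambda>z. \<Sum>b\<in>Basis. (p (snd (fst z)) \<bullet> blinfun_apply (deriv_x F (fst (fst z)) (snd z)) b) *\<^sub>R b)
      (\<lambda>z. \<Sum>b\<in>Basis. (p (snd (fst z)) \<bullet> blinfun_apply (deriv_x F x w) b + p y \<bullet> blinfun_apply (D2 (\<pi> z)) b) *\<^sub>R b)
      ((x, y), w)"
    by (rule has_strict_derivative_sum)
  from has_strict_derivative_add[OF 1 this]
  show thesis
    unfolding blinfun_adjoint_def[symmetric] lagr_grad_def[symmetric] by (rule that)
qed

section \<open>The equilibrium conditions as one generalized equation\<close>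

definition lagr_map ::
  "('n::finite \<Rightarrow> 'p::finite) \<Rightarrow> ('p \<Rightarrow> 'y \<Rightarrow> 'y) \<Rightarrow> ('p \<Rightarrow> real ^ 'n \<Rightarrow> 'd \<Rightarrow> real) \<Rightarrow>
   ('p \<Rightarrow> real ^ 'n \<Rightarrow> 'd \<Rightarrow> 'y::real_inner) \<Rightarrow> real ^ 'n \<Rightarrow> 'y \<Rightarrow> 'd \<Rightarrow> real ^ 'n" where
  "lagr_map own P f F x y w = (\<Sum>\<nu>\<in>UNIV. xblk own \<nu> (lagr_grad (f \<nu>) (F \<nu>) x (P \<nu> y) w))"

definition kkt_graph ::
  "('n::finite \<Rightarrow> 'p::finite) \<Rightarrow> ('p \<Rightarrow> 'y \<Rightarrow> 'y) \<Rightarrow> ('p \<Rightarrow> (real ^ 'n) set) \<Rightarrow> ('p \<Rightarrow> 'y set) \<Rightarrow>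
   (((real ^ 'n) \<times> 'y) \<times> ((real ^ 'n) \<times> 'y::real_inner)) set" where
  "kkt_graph own P X K = prod_rearrange
     (gph (normal_cone (block_product (xblk own) X)))
     (gph (normal_cone (block_product P (\<lambda>\<nu>. polar_in (range (P \<nu>)) (K \<nu>)))))"

text \<open>Projecting the assembled tuples to block \<open>\<nu>\<close> recovers the conditions of
  that player, because different blocks annihilate each other.\<close>

lemma S_Lag_iff:
  fixes own :: "'n::finite \<Rightarrow> 'p::finite" and P :: "'p \<Rightarrow> 'y::euclidean_space \<Rightarrow> 'y"
  assumes P: "orth_decomposition P" and X: "\<And>\<nu>. X \<nu> \<subseteq> range (xblk own \<nu>)"
    and F: "\<And>\<nu>. F \<nu> x w \<in> range (P \<nu>)"
    and diff: "\<And>\<nu>. (\<lambda>x'. f \<nu> x' w) differentiable (at x)" "\<And>\<nu>. (\<lambda>x'. F \<nu> x' w) differentiable (at x)"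
  shows "(x, y) \<in> S_Lag own P X K f F (w, v, u) \<longleftrightarrow>
    ((x, y), (v - lagr_map own P f F x y w, (\<Sum>\<nu>\<in>UNIV. F \<nu> x w) - u)) \<in> kkt_graph own P X K"
proof -
  have image_iff: "0 \<in> (+) a ` N \<longleftrightarrow> - a \<in> N" for a :: "'c::ab_group_add" and N
    by (auto simp: image_iff add_eq_0_iff intro: bexI[of _ "- a"])
  have 1: "- (xblk own \<nu> (lagr_grad (f \<nu>) (F \<nu>) x (P \<nu> y) w) - xblk own \<nu> v) =
      xblk own \<nu> (v - lagr_map own P f F x y w)" for \<nu>
    unfolding lagr_map_def linear_diff[OF orth_decompositionD(1)[OF orth_decomposition_xblk]]
      orth_decomposition_sum_blocks[OF orth_decomposition_xblk] by simp
  have "P \<nu> (F \<nu> x w) = F \<nu> x w" for \<nu>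
    using F orth_decomposition_range_iff[OF P] by blast
  then have "P \<nu> (\<Sum>\<mu>\<in>UNIV. F \<mu> x w) = F \<nu> x w" for \<nu>
    using orth_decomposition_sum_blocks[OF P, of \<nu> "\<lambda>\<mu>. F \<mu> x w"] by simp
  then have 2: "- (P \<nu> u - F \<nu> x w) = P \<nu> ((\<Sum>\<mu>\<in>UNIV. F \<mu> x w) - u)" for \<nu>
    by (simp add: linear_diff[OF orth_decompositionD(1)[OF P]])
  have K: "polar_in (range (P \<nu>)) (K \<nu>) \<subseteq> range (P \<nu>)" for \<nu>
    by (auto simp: polar_in_def)
  show ?thesis
    unfolding S_Lag_def kkt_graph_def prod_rearrange_def gph_def
    by (simp add: image_iff 1 2 pgradient_lagrangian diff
        normal_cone_block_product[OF orth_decomposition_xblk X] normal_cone_block_product[OF P K]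
        all_conj_distrib del: minus_diff_eq minus_add_distrib)
qed

lemma closed_kkt_graph:
  fixes own :: "'n::finite \<Rightarrow> 'p::finite" and P :: "'p \<Rightarrow> 'y::euclidean_space \<Rightarrow> 'y"
  assumes P: "orth_decomposition P" and X: "\<And>\<nu>. closed (X \<nu>)"
  shows "closed (kkt_graph own P X K)"
  unfolding kkt_graph_def
  by (intro closed_prod_rearrange closed_gph_normal_cone closed_block_product orth_decomposition_xblk P X
      closed_polar_in closed_subspace linear_subspace_image[OF orth_decompositionD(1)[OF P]] subspace_UNIV)

text \<open>The minus sign matches \<open>J (v, u) = (v, - u)\<close>: then
  \<open>J q - kkt_fun own P f F (z, w)\<close> is the pair of vectors required to be
  normal.\<close>

definition kkt_fun ::
  "('n::finite \<Rightarrow> 'p::finite) \<Rightarrow> ('p \<Rightarrow> 'y \<Rightarrow> 'y) \<Rightarrow> ('p \<Rightarrow> real ^ 'n \<Rightarrow> 'd \<Rightarrow> real) \<Rightarrow>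
   ('p \<Rightarrow> real ^ 'n \<Rightarrow> 'd \<Rightarrow> 'y::real_inner) \<Rightarrow> ((real ^ 'n) \<times> 'y) \<times> 'd \<Rightarrow> (real ^ 'n) \<times> 'y" where
  "kkt_fun own P f F = (\<lambda>((x, y), w). (lagr_map own P f F x y w, - (\<Sum>\<nu>\<in>UNIV. F \<nu> x w)))"

section \<open>The strict derivative of the equilibrium system and its operator blocks\<close>

lemma smooth_data_onD:
  assumes "smooth_data_on W h Dh" "(x, w) \<in> W"
  shows "(\<lambda>x'. h x' w) differentiable (at x)"
    "strictly_differentiable_at (\<lambda>(x', w'). h x' w') (x, w)"
    "strictly_differentiable_at (\<lambda>(x', w'). Dh x' w') (x, w)"
  using bspec[OF assms(1)[unfolded smooth_data_on_def] assms(2)] by simp_all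

lemma has_derivative_fix_snd:
  assumes "has_strict_derivative h D (z, w)"
  shows "((\<lambda>z. h (z, w)) has_derivative (\<lambda>t. D (t, 0))) (at z)"
proof -
  have "((\<lambda>z. (z, w)) has_derivative (\<lambda>t. (t, 0))) (at z)"
    by (auto intro!: derivative_eq_intros)
  then show ?thesis
    using has_strict_derivative_imp_has_derivative[OF assms] by (rule has_derivative_compose)
qed

lemma has_derivative_slices:
  assumes "(h has_derivative D) (at (x, y))"
  shows "((\<lambda>x. h (x, y)) has_derivative (\<lambda>t. D (t, 0))) (at x)"
    and "((\<lambda>y. h (x, y)) has_derivative (\<lambda>t. D (0, t))) (at y)"
proof -
  have "((\<lambda>x. (x, y)) has_derivative (\<lambda>t. (t, 0))) (at x)"
    by (auto intro!: derivative_eq_intros)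
  then show "((\<lambda>x. h (x, y)) has_derivative (\<lambda>t. D (t, 0))) (at x)"
    using assms by (rule has_derivative_compose)
  have "((\<lambda>y. (x, y)) has_derivative (\<lambda>t. (0, t))) (at y)"
    by (auto intro!: derivative_eq_intros)
  then show "((\<lambda>y. h (x, y)) has_derivative (\<lambda>t. D (0, t))) (at y)"
    using assms by (rule has_derivative_compose)
qed

lemma kkt_fun_strict_derivative:
  fixes own :: "'n::finite \<Rightarrow> 'p::finite" and P :: "'p \<Rightarrow> 'y::euclidean_space \<Rightarrow> 'y"
    and f :: "'p \<Rightarrow> real ^ 'n \<Rightarrow> real ^ 'd::finite \<Rightarrow> real"
  assumes P: "orth_decomposition P"
    and smooth: "\<And>\<nu>. smooth_data_on (W \<nu>) (f \<nu>) (grad_x (f \<nu>))"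
      "\<And>\<nu>. smooth_data_on (W \<nu>) (F \<nu>) (deriv_x (F \<nu>))"
    and W: "\<And>\<nu>. open (W \<nu>)" "\<And>\<nu>. (x, w) \<in> W \<nu>"
    and G: "G = G_op own P (\<lambda>\<nu> x. f \<nu> x w) (\<lambda>\<nu> x. F \<nu> x w) x y"
    and B: "B = B_op own P (\<lambda>\<nu> x. F \<nu> x w) x"
    and A: "A = A_op (\<lambda>\<nu> x. F \<nu> x w) x"
  obtains D where "has_strict_derivative (kkt_fun own P f F) D ((x, y), w)"
    and "\<forall>h k. D ((h, k), 0) = (G h + B k, - A h)" and "linear G" "linear B" "linear A"
proof -
  let ?X = "xblk own"
  note X = orth_decompositionD[OF orth_decomposition_xblk[of own]]
  have blX: "bounded_linear (?X \<nu>)" for \<nu> using X(1) by (simp add: linear_conv_bounded_linear)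
  have smoothD: "(\<lambda>x'. f \<nu> x' w) differentiable (at x)" "(\<lambda>x'. F \<nu> x' w) differentiable (at x)"
    "strictly_differentiable_at (\<lambda>(x', w'). grad_x (f \<nu>) x' w') (x, w)"
    "strictly_differentiable_at (\<lambda>(x', w'). deriv_x (F \<nu>) x' w') (x, w)"
    "strictly_differentiable_at (\<lambda>(x', w'). F \<nu> x' w') (x, w)" for \<nu>
    using smooth_data_onD[OF smooth(1) W(2)] smooth_data_onD[OF smooth(2) W(2)] by blast+
  let ?l = "\<lambda>\<nu> z. lagr_grad (f \<nu>) (F \<nu>) (fst (fst z)) (P \<nu> (snd (fst z))) (snd z)"
  have "\<exists>E. has_strict_derivative (?l \<nu>) E ((x, y), w)" for \<nu>
    by (rule has_strict_derivative_lagr_grad[OF smoothD(3,4) orth_decompositionD(1)[OF P]]) (rule exI)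
  then have "\<exists>E. \<forall>\<nu>. has_strict_derivative (?l \<nu>) (E \<nu>) ((x, y), w)" by (rule choice[OF allI])
  then obtain E where "\<forall>\<nu>. has_strict_derivative (?l \<nu>) (E \<nu>) ((x, y), w)" ..
  then have E: "has_strict_derivative (?l \<nu>) (E \<nu>) ((x, y), w)" for \<nu> ..
  have "\<exists>H. \<forall>\<nu>. has_strict_derivative (\<lambda>(x', w'). F \<nu> x' w') (H \<nu>) (x, w)"
    using smoothD(5) unfolding strictly_differentiable_at_iff by (intro choice allI)
  then obtain H where "\<forall>\<nu>. has_strict_derivative (\<lambda>(x', w'). F \<nu> x' w') (H \<nu>) (x, w)" ..
  then have H: "has_strict_derivative (\<lambda>(x', w'). F \<nu> x' w') (H \<nu>) (x, w)" for \<nu> ..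
  have XE: "has_strict_derivative (\<lambda>z. ?X \<nu> (?l \<nu> z)) (\<lambda>z. ?X \<nu> (E \<nu> z)) ((x, y), w)" for \<nu>
    by (rule has_strict_derivative_linear_compose[OF blX E])
  define \<pi> where "\<pi> = (\<lambda>z :: ((real ^ 'n) \<times> 'y) \<times> (real ^ 'd). (fst (fst z), snd z))"
  have "bounded_linear \<pi>"
    unfolding \<pi>_def
    by (intro bounded_linear_Pair bounded_linear_compose[OF bounded_linear_fst bounded_linear_fst] bounded_linear_snd)
  then have \<pi>: "has_strict_derivative \<pi> \<pi> ((x, y), w)" by (rule has_strict_derivative_linear)
  have \<pi>z: "\<pi> ((x, y), w) = (x, w)" by (simp add: \<pi>_def)
  have H\<pi>: "has_strict_derivative (\<lambda>z. F \<nu> (fst (fst z)) (snd z)) (\<lambda>z. H \<nu> (\<pi> z)) ((x, y), w)" for \<nu>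
    using has_strict_derivative_compose[OF \<pi>, unfolded \<pi>z, OF H[of \<nu>]] by (simp add: \<pi>_def)
  define D where "D = (\<lambda>z. (\<Sum>\<nu>\<in>UNIV. ?X \<nu> (E \<nu> z), - (\<Sum>\<nu>\<in>UNIV. H \<nu> (\<pi> z))))"
  have D: "has_strict_derivative (kkt_fun own P f F) D ((x, y), w)"
    unfolding D_def kkt_fun_def lagr_map_def split_beta
    by (intro has_strict_derivative_Pair has_strict_derivative_sum XE H\<pi>
        has_strict_derivative_linear_compose[OF bounded_linear_minus[OF bounded_linear_ident]])
  have E': "((\<lambda>z. ?X \<nu> (lagr_grad (f \<nu>) (F \<nu>) (fst z) (P \<nu> (snd z)) w)) has_derivative
      (\<lambda>t. ?X \<nu> (E \<nu> (t, 0)))) (at (x, y))" for \<nu>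
    using has_derivative_fix_snd[OF XE[of \<nu>]] by simp
  have linE: "linear (\<lambda>t. ?X \<nu> (E \<nu> (t, 0)))" for \<nu>
    by (rule has_derivative_linear[OF E'])
  have "G h = (\<Sum>\<nu>\<in>UNIV. ?X \<nu> (E \<nu> ((h, 0), 0)))" for h
  proof -
    have pg: "(pgradient own \<nu> (\<lambda>x'. l_fun (\<lambda>\<nu> x. f \<nu> x w) (\<lambda>\<nu> x. F \<nu> x w) \<nu> x' (P \<nu> y)) has_derivative
        (\<lambda>t. ?X \<nu> (E \<nu> ((t, 0), 0)))) (at x)" for \<nu>
    \<comment> \<open>The formula for the partial gradient holds only where the data are
      differentiable; the open slice of \<open>W \<nu>\<close> at \<open>w\<close> is enough for a
      derivative at \<open>x\<close>.\<close>
    proof (rule has_derivative_transform_within_open)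
      show "((\<lambda>x. ?X \<nu> (lagr_grad (f \<nu>) (F \<nu>) x (P \<nu> y) w)) has_derivative (\<lambda>t. ?X \<nu> (E \<nu> ((t, 0), 0)))) (at x)"
        using has_derivative_slices(1)[OF E'[of \<nu>]] by simp
      show "open ((\<lambda>x. (x, w)) -` W \<nu>)"
        using W(1) by (intro open_vimage continuous_intros)
      show "x \<in> (\<lambda>x. (x, w)) -` W \<nu>" using W(2) by simp
      fix x' assume "x' \<in> (\<lambda>x. (x, w)) -` W \<nu>"
      then have "(\<lambda>x. f \<nu> x w) differentiable (at x')" "(\<lambda>x. F \<nu> x w) differentiable (at x')"
        using smooth_data_onD(1)[OF smooth(1)] smooth_data_onD(1)[OF smooth(2)] by simp_all
      then show "?X \<nu> (lagr_grad (f \<nu>) (F \<nu>) x' (P \<nu> y) w) =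
          pgradient own \<nu> (\<lambda>x'. l_fun (\<lambda>\<nu> x. f \<nu> x w) (\<lambda>\<nu> x. F \<nu> x w) \<nu> x' (P \<nu> y)) x'"
        by (simp add: pgradient_l_fun)
    qed
    have lin: "linear (\<lambda>t. ?X \<nu> (E \<nu> ((t, 0), 0)))" for \<nu>
      by (rule has_derivative_linear[OF pg])
    \<comment> \<open>\<open>pderivative\<close> projects its argument and \<open>G_op\<close>
      projects it once more, hence the doubled \<open>?X \<mu>\<close>; summing over
      \<open>\<mu>\<close> restores \<open>h\<close>.\<close>
    have "(\<Sum>\<mu>\<in>UNIV. ?X \<nu> (E \<nu> ((?X \<mu> (?X \<mu> h), 0), 0))) = ?X \<nu> (E \<nu> ((h, 0), 0))" for \<nu>
      using linear_sum[OF lin, of \<nu> "\<lambda>\<mu>. ?X \<mu> h" UNIV] by (simp add: X(3,4))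
    then show ?thesis
      unfolding G G_op_def pderivative_eq[OF pg] by simp
  qed
  moreover have "B k = (\<Sum>\<nu>\<in>UNIV. ?X \<nu> (E \<nu> ((0, k), 0)))" for k
  proof -
    have "adjoint (pderivative own \<nu> (\<lambda>x. F \<nu> x w) x) (P \<nu> k) = ?X \<nu> (E \<nu> ((0, k), 0))" for \<nu>
    proof -
      let ?T = "deriv_x (F \<nu>) x w"
      have e1: "pderivative own \<nu> (\<lambda>x. F \<nu> x w) x = (\<lambda>t. blinfun_apply ?T (?X \<nu> t))"
        using pderivative_eq[OF deriv_x_has_derivative[of "F \<nu>" w x, OF smoothD(2)]] by (rule ext)
      have e2: "adjoint (\<lambda>t. blinfun_apply ?T (?X \<nu> t)) = (\<lambda>k. ?X \<nu> (blinfun_adjoint ?T k))"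
        by (rule adjoint_unique) (simp add: X(2)[symmetric] blinfun_adjoint_inner inner_commute)
      \<comment> \<open>The block gradient is affine in the multiplier, so its derivative in
        \<open>y\<close> can be read off directly and compared with the slice of
        \<open>E \<nu>\<close>.\<close>
      have e3: "(\<lambda>k. ?X \<nu> (blinfun_adjoint ?T (P \<nu> k))) = (\<lambda>k. ?X \<nu> (E \<nu> ((0, k), 0)))"
      proof (rule has_derivative_unique)
        let ?h = "\<lambda>y. ?X \<nu> (lagr_grad (f \<nu>) (F \<nu>) x (P \<nu> y) w)"
        show "(?h has_derivative (\<lambda>t. ?X \<nu> (E \<nu> ((0, t), 0)))) (at y)"
          using has_derivative_slices(2)[OF E'[of \<nu>]] by simp
        have "linear (\<lambda>k. ?X \<nu> (blinfun_adjoint ?T (P \<nu> k)))"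
          using linear_compose[OF linear_compose[OF orth_decompositionD(1)[OF P] linear_blinfun_adjoint] X(1)]
          by (simp add: o_def)
        then have "((\<lambda>k. ?X \<nu> (grad_x (f \<nu>) x w) + ?X \<nu> (blinfun_adjoint ?T (P \<nu> k))) has_derivative
            (\<lambda>k. ?X \<nu> (blinfun_adjoint ?T (P \<nu> k)))) (at y)"
          by (auto intro!: derivative_eq_intros linear_imp_has_derivative)
        then show "(?h has_derivative (\<lambda>k. ?X \<nu> (blinfun_adjoint ?T (P \<nu> k)))) (at y)"
          by (simp add: lagr_grad_def linear_add[OF X(1)])
      qed
      show ?thesis by (simp add: e1 e2 fun_cong[OF e3])
    qed
    then show ?thesis by (simp add: B B_op_def)
  qed
  moreover have "A h = (\<Sum>\<nu>\<in>UNIV. H \<nu> (h, 0))" for h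
  proof -
    have "(g_map (\<lambda>\<nu> x. F \<nu> x w) has_derivative (\<lambda>h. \<Sum>\<nu>\<in>UNIV. H \<nu> (h, 0))) (at x)"
      unfolding g_map_def using has_derivative_fix_snd[OF H] by (intro has_derivative_sum) simp
    from frechet_derivative_at[OF this, symmetric] show ?thesis by (simp add: A A_op_def)
  qed
  ultimately have GBA: "G = (\<lambda>h. \<Sum>\<nu>\<in>UNIV. ?X \<nu> (E \<nu> ((h, 0), 0)))"
    "B = (\<lambda>k. \<Sum>\<nu>\<in>UNIV. ?X \<nu> (E \<nu> ((0, k), 0)))" "A = (\<lambda>h. \<Sum>\<nu>\<in>UNIV. H \<nu> (h, 0))"
    by auto
  have XE_add: "?X \<nu> (E \<nu> ((h, k), 0)) = ?X \<nu> (E \<nu> ((h, 0), 0)) + ?X \<nu> (E \<nu> ((0, k), 0))" for \<nu> h k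
    using linear_add[OF linE, of \<nu> "(h, 0)" "(0, k)"] by simp
  have val: "\<forall>h k. D ((h, k), 0) = (G h + B k, - A h)"
  proof (intro allI)
    fix h k
    have "(\<Sum>\<nu>\<in>UNIV. ?X \<nu> (E \<nu> ((h, k), 0))) = G h + B k"
      unfolding GBA(1,2) sum.distrib[symmetric] by (intro sum.cong refl XE_add)
    then show "D ((h, k), 0) = (G h + B k, - A h)"
      by (simp add: D_def GBA(3) \<pi>_def)
  qed
  have "linear (\<lambda>h. ?X \<nu> (E \<nu> ((h, 0), 0)))" "linear (\<lambda>k. ?X \<nu> (E \<nu> ((0, k), 0)))" for \<nu>
    by (rule has_derivative_linear[OF has_derivative_slices(1)[OF E']],
        rule has_derivative_linear[OF has_derivative_slices(2)[OF E']])
  moreover have "linear (\<lambda>h. H \<nu> (h, 0))" for \<nu>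
    by (rule has_derivative_linear[OF has_derivative_fix_snd[OF H]])
  ultimately have "linear G" "linear B" "linear A"
    unfolding GBA by (auto intro: linear_compose_sum)
  then show thesis by (rule that[OF D val])
qed

theorem theorem2p1:
  fixes own :: "'n::finite \<Rightarrow> 'p::finite"
    and P :: "'p \<Rightarrow> 'y::euclidean_space \<Rightarrow> 'y"
    and X :: "'p \<Rightarrow> (real ^ 'n) set"
    and K :: "'p \<Rightarrow> 'y set"
    and f :: "'p \<Rightarrow> real ^ 'n \<Rightarrow> real ^ 'd::finite \<Rightarrow> real"
    and F :: "'p \<Rightarrow> real ^ 'n \<Rightarrow> real ^ 'd \<Rightarrow> 'y"
    and wbar :: "real ^ 'd"
    and xbar :: "real ^ 'n" and ybar :: "'y"
    and \<theta> :: "'p \<Rightarrow> real ^ 'n \<Rightarrow> real" and g :: "'p \<Rightarrow> real ^ 'n \<Rightarrow> 'y"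
    and G :: "real ^ 'n \<Rightarrow> real ^ 'n" and B :: "'y \<Rightarrow> real ^ 'n" and A :: "real ^ 'n \<Rightarrow> 'y"
    and q1 :: "real ^ 'n" and q2 :: "'y"
  assumes "orth_decomposition P"
    and "\<And>\<nu>. X \<nu> \<subseteq> range (xblk own \<nu>)"
    and "\<And>\<nu>. X \<nu> \<noteq> {}" and "\<And>\<nu>. closed (X \<nu>)" and "\<And>\<nu>. convex (X \<nu>)"
    and "\<And>\<nu>. K \<nu> \<subseteq> range (P \<nu>)"
    and "\<And>\<nu>. K \<nu> \<noteq> {}" and "\<And>\<nu>. closed (K \<nu>)" and "\<And>\<nu>. convex (K \<nu>)" and "\<And>\<nu>. cone (K \<nu>)"
    and "\<And>\<nu> x w. F \<nu> x w \<in> range (P \<nu>)"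
    and "(xbar, ybar) \<in> S_Lag own P X K f F (wbar, 0, 0)"
    and "\<And>\<nu>. \<exists>W. open W \<and> (xbar, wbar) \<in> W \<and>
               smooth_data_on W (f \<nu>) (grad_x (f \<nu>)) \<and> smooth_data_on W (F \<nu>) (deriv_x (F \<nu>))"
    and \<theta>_def: "\<theta> = (\<lambda>\<nu> x. f \<nu> x wbar)"
    and g_def: "g = (\<lambda>\<nu> x. F \<nu> x wbar)"
    and G_def: "G = G_op own P \<theta> g xbar ybar"
    and B_def: "B = B_op own P g xbar"
    and A_def: "A = A_op g xbar"
    and q1_def: "q1 = l_map own P \<theta> g xbar ybar - G xbar - B ybar"
    and q2_def: "q2 = - g_map g xbar + A xbar"
  shows "aubin_property (S_Lag own P X K f F) (wbar, 0, 0) (xbar, ybar) \<longleftrightarrow>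
    (\<forall>w1 w2.
       adjoint G w1 - adjoint A w2
         \<in> coderivative (normal_cone (block_product (xblk own) X))
             xbar (- q1 - G xbar - B ybar) (- w1) \<and>
       adjoint B w1
         \<in> coderivative (normal_cone (block_product P (\<lambda>\<nu>. polar_in (range (P \<nu>)) (K \<nu>))))
             ybar (- q2 + A xbar) (- w2)
       \<longrightarrow> w1 = 0 \<and> w2 = 0)"
proof -
  note P = assms(1) and X_sub = assms(2) and X_closed = assms(4) and F_range = assms(11) and sol = assms(12)
    and smooth = assms(13)
  have "\<exists>W. \<forall>\<nu>. open (W \<nu>) \<and> (xbar, wbar) \<in> W \<nu> \<and>
      smooth_data_on (W \<nu>) (f \<nu>) (grad_x (f \<nu>)) \<and> smooth_data_on (W \<nu>) (F \<nu>) (deriv_x (F \<nu>))"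
    using smooth by (intro choice allI)
  then obtain W where "\<forall>\<nu>. open (W \<nu>) \<and> (xbar, wbar) \<in> W \<nu> \<and>
      smooth_data_on (W \<nu>) (f \<nu>) (grad_x (f \<nu>)) \<and> smooth_data_on (W \<nu>) (F \<nu>) (deriv_x (F \<nu>))" ..
  then have W: "open (W \<nu>)" "(xbar, wbar) \<in> W \<nu>"
    "smooth_data_on (W \<nu>) (f \<nu>) (grad_x (f \<nu>))" "smooth_data_on (W \<nu>) (F \<nu>) (deriv_x (F \<nu>))" for \<nu>
    by simp_all
  note diff = smooth_data_onD(1)[OF W(3)] smooth_data_onD(1)[OF W(4)]
  obtain D where D: "has_strict_derivative (kkt_fun own P f F) D ((xbar, ybar), wbar)"
    and D_eq: "\<forall>h k. D ((h, k), 0) = (G h + B k, - A h)" and lin: "linear G" "linear B" "linear A"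
    by (rule kkt_fun_strict_derivative[OF P W(3,4,1,2) G_def[unfolded \<theta>_def g_def]
          B_def[unfolded g_def] A_def[unfolded g_def]])
  define T where "T = adjoint (\<lambda>h. D (h, 0))"
  define J :: "(real ^ 'n) \<times> 'y \<Rightarrow> (real ^ 'n) \<times> 'y" where "J = (\<lambda>(v, u). (v, - u))"
  \<comment> \<open>Transposing the block operator
    \<open>(h, k) \<mapsto> (G h + B k, - A h)\<close> produces the two left-hand sides of the
    coderivative conditions.\<close>
  have T_eq: "T = (\<lambda>(w1, w2). (adjoint G w1 - adjoint A w2, adjoint B w1))"
    unfolding T_def
    by (rule adjoint_unique)
      (auto simp: D_eq inner_add_left inner_diff_right adjoint_works[OF lin(1)] adjoint_works[OF lin(2)]
        adjoint_works[OF lin(3)])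
  have J: "orthogonal_transformation J"
    unfolding orthogonal_transformation_def J_def by (auto intro!: linearI)
  have S_iff: "z \<in> S_Lag own P X K f F (w, q) \<longleftrightarrow> (z, J q - kkt_fun own P f F (z, w)) \<in> kkt_graph own P X K"
    if "\<forall>\<nu>. (fst z, w) \<in> W \<nu>" for z w q
  proof -
    obtain x y v u where "z = (x, y)" "q = (v, u)" by (metis surj_pair)
    then show ?thesis
      using S_Lag_iff[where F = F and x = x and w = w, OF P X_sub F_range diff] that
      by (simp add: J_def kkt_fun_def)
  qed
  have base: "((xbar, ybar), - kkt_fun own P f F ((xbar, ybar), wbar)) \<in> kkt_graph own P X K"
  proof -
    have "J (0, 0) = 0" by (simp add: J_def zero_prod_def)
    then show ?thesis
      using sol S_iff[of "(xbar, ybar)" wbar "(0, 0)"] W(2) by simp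
  qed
  interpret generalized_equation "kkt_fun own P f F" D T "kkt_graph own P X K" J "S_Lag own P X K f F"
    "(xbar, ybar)" wbar
  proof
    have "\<forall>\<^sub>F p in nhds ((xbar, ybar), wbar). (fst (fst p), snd p) \<in> W \<nu>" for \<nu>
    proof -
      have "open ((\<lambda>p. (fst (fst p), snd p)) -` W \<nu> :: (((real ^ 'n) \<times> 'y) \<times> (real ^ 'd)) set)"
        by (intro open_vimage W(1) continuous_intros)
      then show ?thesis
        using eventually_nhds_in_open W(2)[of \<nu>] by fastforce
    qed
    \<comment> \<open>Each player has its own neighbourhood; finiteness of the player type gives a
      common one.\<close>
    then have "\<forall>\<^sub>F p in nhds ((xbar, ybar), wbar). \<forall>\<nu>. (fst (fst p), snd p) \<in> W \<nu>"
      by (intro eventually_all_finite)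
    then show "\<forall>\<^sub>F (z, w) in nhds ((xbar, ybar), wbar). \<forall>q. z \<in> S_Lag own P X K f F (w, q) \<longleftrightarrow>
        (z, J q - kkt_fun own P f F (z, w)) \<in> kkt_graph own P X K"
      by eventually_elim (auto simp: S_iff)
  qed (fact D T_def closed_kkt_graph[OF P X_closed] J base)+
  have l: "l_map own P \<theta> g xbar ybar = lagr_map own P f F xbar ybar wbar"
    unfolding l_map_def lagr_map_def \<theta>_def g_def
    by (intro sum.cong refl pgradient_l_fun diff W(2))
  have q: "- q1 - G xbar - B ybar = - lagr_map own P f F xbar ybar wbar"
    "- q2 + A xbar = (\<Sum>\<nu>\<in>UNIV. F \<nu> xbar wbar)"
    unfolding q1_def q2_def l by (simp_all add: g_map_def g_def)
  have "aubin_property (S_Lag own P X K f F) (wbar, 0, 0) (xbar, ybar) \<longleftrightarrow>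
    (\<forall>\<eta>. (T \<eta>, \<eta>) \<in> limiting_normal_cone (kkt_graph own P X K)
        ((xbar, ybar), - kkt_fun own P f F ((xbar, ybar), wbar)) \<longrightarrow> \<eta> = 0)"
    using aubin_iff_injective by (simp add: zero_prod_def)
  also have "\<dots> \<longleftrightarrow> (\<forall>w1 w2. ((adjoint G w1 - adjoint A w2, adjoint B w1), (w1, w2)) \<in>
      limiting_normal_cone (kkt_graph own P X K) ((xbar, ybar),
        (- lagr_map own P f F xbar ybar wbar, \<Sum>\<nu>\<in>UNIV. F \<nu> xbar wbar)) \<longrightarrow> w1 = 0 \<and> w2 = 0)"
    by (simp add: T_eq kkt_fun_def zero_prod_def)
  \<comment> \<open>The arguments \<open>- w1\<close> and \<open>- w2\<close> cancel the minus sign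
    in \<open>coderivative\<close>, so the two premises are exactly the two factors of the normal
    cone to the product graph.\<close>
  finally show ?thesis
    unfolding kkt_graph_def limiting_normal_cone_prod_rearrange coderivative_def q by simp
qed

end
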